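(* Let $S$ be an inverse semigroup (with zero). Consider the following conditions. (1) $S$ has a strongly tight action $\alpha\colon S\curvearrowright X$ on a compact Hausdorff space $X$. (2) $\widehat{E}_{\infty}(S)$ is compact. (3) $\widehat{E}_{\mathrm{tight}}(S)=\widehat{E}_{\infty}(S)$. Then $(1)\Leftrightarrow(2)$ and $(2)\Rightarrow(3)$ hold. If $S$ has a unit element, then $(3)\Rightarrow(2)$ also holds. Moreover, if (1) holds, then (for $\alpha$ and $X$ as in (1)) the groupoid $S\ltimes_{\alpha}X$ is isomorphic to $G_{\mathrm{tight}}(S)$.
   Context: An inverse semigroup is a semigroup $S$ such that every $s\in S$ has a unique $s^*$ with $s=ss^*s$, $s^*=s^*ss^*$; all inverse semigroups are assumed to have a zero $0$. $E(S)$ is the set of idempotents, ordered by $e\le f$ iff $ef=e$. For a topological space $X$, $I_X$ is the inverse semigroup of homeomorphisms between open subsets of $X$. An action $\alpha\colon S\curvearrowright X$ is a semigroup homomorphism $s\mapsto\alpha_s\in I_X$ with $\bigcup_{e\in E(S)}\operatorname{dom}(\alpha_e)=X$ and $\operatorname{dom}(\alpha_0)=\emptyset$; $D_e:=\operatorname{dom}(\alpha_e)$ for $e\in E(S)$, so $\alpha_s\colon D_{s^*s}\to D_{ss^*}$ is a homeomorphism. The action is strongly tight if every $D_e$ is compact and $\{D_e\}_{e\in E(S)}$ is a basis of $X$. $S\ltimes_{\alpha}X$ is the étale groupoid of classes $[s,x]$ ($s\in S$, $x\in D_{s^*s}$), with $[s,x]=[t,y]$ iff $x=y$ and $se=te$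 for some $e\in E(S)$ with $x\in D_e$; unit space $X$ ($x=[e,x]$ for $x\in D_e$), $d([s,x])=x$, $r([s,x])=\alpha_s(x)$, $[s,\alpha_t(x)][t,x]=[st,x]$, $[s,x]^{-1}=[s^*,\alpha_s(x)]$, topology with basis the sets $\{[s,x]\mid x\in U\}$, $U\subset D_{s^*s}$ open. A character on $E(S)$ is a nonzero semigroup homomorphism $\xi\colon E(S)\to\{0,1\}$ with $\xi(0)=0$ (so that $\xi^{-1}(\{1\})$ is a proper filter). $\widehat{E}(S)$ is the set of characters with the topology of pointwise convergence, a locally compact Hausdorff space. A character $\xi$ is an ultracharacter if $\xi^{-1}(\{1\})$ is a maximal proper filter, equivalently there is no character $\eta$ with $\xi<\eta$ pointwise. $\widehat{E}_{\infty}(S)$ is the set of ultracharacters (with the subspace topology) and $\widehat{E}_{\mathrm{tight}}(S)$ its closure in $\widehat{E}(S)$. The spectral action of $S$ on $\widehat{E}(S)$ is $\beta_s\colon\{\xi\mid\xi(s^*s)=1\}\to\{\xi\mid\xi(ss^* )=1\}$, $\beta_s(\xi)(e):=\xi(s^*es)$. It restricts to an action $\theta$ on the invariant set $\widehat{E}_{\mathrm{tight}}(S)$, and $G_{\mathrm{tight}}(S):=S\ltimes_{\theta}\widehat{E}_{\mathrm{tight}}(S)$.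
   Formalization: In condition (1), and hence in the final groupoid claim, the action is additionally required to have D_e nonempty for every nonzero idempotent e; without this, (1)⇒(2) and the isomorphism with G_tight(S) fail. *)

theory Defs
  imports "HOL-Analysis.Analysis"
begin

section \<open>Inverse semigroups with zero\<close>

class inverse_semigroup = semigroup_mult + mult_zero +
  assumes ex1_inverse: "\<exists>!t. s = s * t * s \<and> t = t * s * t"

definition star :: "'s::inverse_semigroup \<Rightarrow> 's" where
  "star s = (THE t. s = s * t * s \<and> t = t * s * t)"

definition idempotents :: "'s::inverse_semigroup set" where
  "idempotents = {e. e * e = e}"

definition idem_le :: "'s::inverse_semigroup \<Rightarrow> 's \<Rightarrow> bool" where
  "idem_le e f \<longleftrightarrow> e * f = e"

definition has_unit :: "'s::inverse_semigroup itself \<Rightarrow> bool" where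
  "has_unit _ \<longleftrightarrow> (\<exists>u::'s. \<forall>s. u * s = s \<and> s * u = s)"


section \<open>Actions on topological spaces\<close>

text \<open>The elements of $I_X$ are partial maps; the product of $I_X$ is then the library
  composition of partial maps, which has the largest possible domain.\<close>

definition partial_homeos :: "'x topology \<Rightarrow> ('x \<rightharpoonup> 'x) set" where
  "partial_homeos X = {f. openin X (dom f) \<and> openin X (ran f) \<and>
     homeomorphic_map (subtopology X (dom f)) (subtopology X (ran f)) (the \<circ> f)}"

definition action :: "'x topology \<Rightarrow> ('s::inverse_semigroup \<Rightarrow> 'x \<rightharpoonup> 'x) \<Rightarrow> bool" where
  "action X \<alpha> \<longleftrightarrow>
     (\<forall>s. \<alpha> s \<in> partial_homeos X) \<and>
     (\<forall>s t. \<alpha> (s * t) = \<alpha> s \<circ>\<^sub>m \<alpha> t) \<and>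
     (\<Union>e\<in>idempotents. dom (\<alpha> e)) = topspace X \<and>
     dom (\<alpha> 0) = {}"

definition strongly_tight :: "'x topology \<Rightarrow> ('s::inverse_semigroup \<Rightarrow> 'x \<rightharpoonup> 'x) \<Rightarrow> bool" where
  "strongly_tight X \<alpha> \<longleftrightarrow>
     (\<forall>e\<in>idempotents. compactin X (dom (\<alpha> e))) \<and>
     openin X = arbitrary union_of (\<lambda>U. U \<in> (\<lambda>e. dom (\<alpha> e)) ` idempotents)"

text \<open>Strong tightness alone does not prevent a nonzero idempotent from acting as the empty map.
  This must be excluded for strongly tight actions to determine the ultracharacters: the semilattice
  $\{0, 1\} \cup \{e_n \mid n \in \mathbb{N}\}$ with $e_m e_n = 0$ for $m \neq n$ acts on a point,
  with $1$ acting as the identity and all other elements as the empty map; this action is strongly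
  tight, but the space of ultracharacters is infinite and discrete.\<close>

definition nonvanishing :: "('s::inverse_semigroup \<Rightarrow> 'x \<rightharpoonup> 'x) \<Rightarrow> bool" where
  "nonvanishing \<alpha> \<longleftrightarrow> (\<forall>e\<in>idempotents. e \<noteq> 0 \<longrightarrow> dom (\<alpha> e) \<noteq> {})"


section \<open>Topological groupoids and their isomorphisms\<close>

text \<open>The unit space is a space of its own, embedded into the arrows by \<open>unit_at\<close>. The product
  \<open>gcomp g h\<close> is meaningful only if the source of \<open>g\<close> is the range of \<open>h\<close>.\<close>

record ('g, 'x) top_groupoid =
  arrows :: "'g topology"
  units :: "'x topology"
  unit_at :: "'x \<Rightarrow> 'g"
  src :: "'g \<Rightarrow> 'x"
  rng :: "'g \<Rightarrow> 'x"
  gcomp :: "'g \<Rightarrow> 'g \<Rightarrow> 'g"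
  ginv :: "'g \<Rightarrow> 'g"

definition groupoid_isomorphic :: "('g, 'x) top_groupoid \<Rightarrow> ('h, 'y) top_groupoid \<Rightarrow> bool" where
  "groupoid_isomorphic G H \<longleftrightarrow> (\<exists>\<phi> \<phi>\<^sub>0.
     homeomorphic_map (arrows G) (arrows H) \<phi> \<and>
     homeomorphic_map (units G) (units H) \<phi>\<^sub>0 \<and>
     (\<forall>x\<in>topspace (units G). \<phi> (unit_at G x) = unit_at H (\<phi>\<^sub>0 x)) \<and>
     (\<forall>g\<in>topspace (arrows G). src H (\<phi> g) = \<phi>\<^sub>0 (src G g)) \<and>
     (\<forall>g\<in>topspace (arrows G). rng H (\<phi> g) = \<phi>\<^sub>0 (rng G g)) \<and>
     (\<forall>g\<in>topspace (arrows G). \<forall>h\<in>topspace (arrows G).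
        src G g = rng G h \<longrightarrow> \<phi> (gcomp G g h) = gcomp H (\<phi> g) (\<phi> h)) \<and>
     (\<forall>g\<in>topspace (arrows G). \<phi> (ginv G g) = ginv H (\<phi> g)))"


section \<open>The groupoid of germs of an action\<close>

definition germ_rel ::
  "('s::inverse_semigroup \<Rightarrow> 'x \<rightharpoonup> 'x) \<Rightarrow> (('s \<times> 'x) \<times> ('s \<times> 'x)) set" where
  "germ_rel \<alpha> = {((s, x), (t, y)).
     x \<in> dom (\<alpha> (star s * s)) \<and> y \<in> dom (\<alpha> (star t * t)) \<and> x = y \<and>
     (\<exists>e\<in>idempotents. x \<in> dom (\<alpha> e) \<and> s * e = t * e)}"

definition germ :: "('s::inverse_semigroup \<Rightarrow> 'x \<rightharpoonup> 'x) \<Rightarrow> 's \<Rightarrow> 'x \<Rightarrow> ('s \<times> 'x) set" where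
  "germ \<alpha> s x = germ_rel \<alpha> `` {(s, x)}"

text \<open>The sets generating the topology of the arrows are closed under binary intersections up to
  unions, so they form a basis of it. The operations are given on representatives; the descriptions
  below select the value that all representatives share.\<close>

definition germ_groupoid ::
  "'x topology \<Rightarrow> ('s::inverse_semigroup \<Rightarrow> 'x \<rightharpoonup> 'x) \<Rightarrow> (('s \<times> 'x) set, 'x) top_groupoid" where
  "germ_groupoid X \<alpha> = \<lparr>
     arrows = topology_generated_by
       {germ \<alpha> s ` U | s U. openin X U \<and> U \<subseteq> dom (\<alpha> (star s * s))},
     units = X,
     unit_at = (\<lambda>x. THE g. \<exists>e\<in>idempotents. x \<in> dom (\<alpha> e) \<and> g = germ \<alpha> e x),
     src = (\<lambda>g. THE x. \<exists>s. x \<in> dom (\<alpha> (star s * s)) \<and> g = germ \<alpha> s x),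
     rng = (\<lambda>g. THE y. \<exists>s x. x \<in> dom (\<alpha> (star s * s)) \<and> g = germ \<alpha> s x \<and> y = the (\<alpha> s x)),
     gcomp = (\<lambda>g h. THE k. \<exists>s t x. x \<in> dom (\<alpha> (star t * t)) \<and>
       the (\<alpha> t x) \<in> dom (\<alpha> (star s * s)) \<and>
       g = germ \<alpha> s (the (\<alpha> t x)) \<and> h = germ \<alpha> t x \<and> k = germ \<alpha> (s * t) x),
     ginv = (\<lambda>g. THE k. \<exists>s x. x \<in> dom (\<alpha> (star s * s)) \<and>
       g = germ \<alpha> s x \<and> k = germ \<alpha> (star s) (the (\<alpha> s x)))\<rparr>"


section \<open>Characters and the tight groupoid\<close>

text \<open>The semigroup $\{0,1\}$ is \<^typ>\<open>bool\<close> under conjunction. Characters are functions on the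
  idempotents only, hence extensional as functions on the whole type.\<close>

definition characters :: "('s::inverse_semigroup \<Rightarrow> bool) set" where
  "characters = {\<xi> \<in> extensional idempotents.
     (\<forall>e\<in>idempotents. \<forall>f\<in>idempotents. \<xi> (e * f) = (\<xi> e \<and> \<xi> f)) \<and>
     (\<exists>e\<in>idempotents. \<xi> e) \<and> \<not> \<xi> 0}"

definition proper_filter :: "'s::inverse_semigroup set \<Rightarrow> bool" where
  "proper_filter F \<longleftrightarrow> F \<subseteq> idempotents \<and> F \<noteq> {} \<and> 0 \<notin> F \<and>
     (\<forall>e\<in>F. \<forall>f\<in>F. e * f \<in> F) \<and>
     (\<forall>e\<in>F. \<forall>f\<in>idempotents. idem_le e f \<longrightarrow> f \<in> F)"

definition ultracharacters :: "('s::inverse_semigroup \<Rightarrow> bool) set" where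
  "ultracharacters = {\<xi> \<in> characters. proper_filter {e \<in> idempotents. \<xi> e} \<and>
     (\<forall>F. proper_filter F \<longrightarrow> {e \<in> idempotents. \<xi> e} \<subseteq> F \<longrightarrow> F = {e \<in> idempotents. \<xi> e})}"

definition character_space :: "('s::inverse_semigroup \<Rightarrow> bool) topology" where
  "character_space =
     subtopology (product_topology (\<lambda>_. discrete_topology UNIV) idempotents) characters"

definition tight_characters :: "('s::inverse_semigroup \<Rightarrow> bool) set" where
  "tight_characters = character_space closure_of ultracharacters"

definition ultra_space :: "('s::inverse_semigroup \<Rightarrow> bool) topology" where
  "ultra_space = subtopology character_space ultracharacters"

definition tight_space :: "('s::inverse_semigroup \<Rightarrow> bool) topology" where
  "tight_space = subtopology character_space tight_characters"

definition spectral_action ::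
  "'s::inverse_semigroup \<Rightarrow> ('s \<Rightarrow> bool) \<rightharpoonup> ('s \<Rightarrow> bool)" where
  "spectral_action s = (\<lambda>\<xi>. if \<xi> \<in> characters \<and> \<xi> (star s * s)
     then Some (\<lambda>e\<in>idempotents. \<xi> (star s * e * s)) else None)"

definition tight_action ::
  "'s::inverse_semigroup \<Rightarrow> ('s \<Rightarrow> bool) \<rightharpoonup> ('s \<Rightarrow> bool)" where
  "tight_action s = spectral_action s |` tight_characters"

definition tight_groupoid ::
  "(('s::inverse_semigroup \<times> ('s \<Rightarrow> bool)) set, 's \<Rightarrow> bool) top_groupoid" where
  "tight_groupoid = germ_groupoid tight_space tight_action"

end

theory Submission
  imports Defs
begin

text \<open>For a strongly tight action on a compact Hausdorff space \<open>X\<close>, a point \<open>x\<close> is sent to the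
  character \<open>e \<mapsto> (x \<in> D\<^sub>e)\<close>. The sets \<open>D\<^sub>e\<close> form a clopen basis and \<open>D\<^sub>e \<inter> D\<^sub>f = {}\<close> forces \<open>e * f = 0\<close>,
  so these characters are exactly the \<open>\<xi>\<close> such that every \<open>e\<close> with \<open>\<not> \<xi> e\<close> is orthogonal to some
  \<open>f\<close> with \<open>\<xi> f\<close>, and those are the ultracharacters. Compactness of \<open>X\<close> makes every ultracharacter
  arise from a point and makes the bijection an equivariant homeomorphism, which induces an
  isomorphism of the groupoids of germs. Conversely, if the space of ultracharacters is compact,
  then the spectral action on it is strongly tight.\<close>

section \<open>Inverse semigroups\<close>

text \<open>That disjoint \<open>D\<^sub>e\<close> and \<open>D\<^sub>f\<close> force
  \<open>e * f = 0\<close> rests on \<open>nonvanishing\<close>: the domain of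
  \<open>\<alpha> (e * f)\<close> is the intersection. For the spectral action on the
  ultracharacters this property is the existence of an ultracharacter through every nonzero
  idempotent, which is where Zorn's lemma enters. Compactness is used through the finite
  intersection property: the \<open>D\<^sub>e\<close> with \<xi> e have a common point, and
  maximality of \<xi> excludes this point from all other \<open>D\<^sub>e\<close>. The passage
  between compactness of the ultracharacters and their agreement with the tight characters is purely
  topological. Compact subsets of the Hausdorff character space are closed. Conversely, a unit turns
  the requirement that a character be nonzero into a closed condition on one coordinate, so that the
  whole character space is compact. Agreement of the two sets of characters also identifies the
  tight groupoid with the groupoid of germs over the ultracharacters.\<close>

lemma star_inverse:
  fixes s :: "'s::inverse_semigroup"
  shows "s * star s * s = s" "star s * s * star s = star s"
  using theI'[OF ex1_inverse[of s]] unfolding star_def by auto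

lemma star_unique:
  fixes s :: "'s::inverse_semigroup"
  assumes "s * t * s = s" "t * s * t = t"
  shows "star s = t"
  using ex1_inverse[of s] star_inverse[of s] assms by metis

lemma star_star [simp]: "star (star s) = (s :: 's::inverse_semigroup)"
  by (rule star_unique) (simp_all add: star_inverse)

lemma idempotentsD: "e \<in> idempotents \<Longrightarrow> e * e = e"
  by (simp add: idempotents_def)

lemma idempotent_left: "e \<in> idempotents \<Longrightarrow> e * (e * s) = e * s"
  by (simp add: idempotents_def flip: mult.assoc)

lemma star_idempotent: "e \<in> idempotents \<Longrightarrow> star e = e"
  by (rule star_unique) (simp_all add: idempotents_def)

text \<open>With x the inverse of e * f, the element f * x * e is another inverse, so uniqueness
  gives x = f * x * e. This form makes x idempotent, hence its own inverse, and therefore equal to e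
  * f.\<close>

lemma idempotent_mult_idempotent:
  fixes e f :: "'s::inverse_semigroup"
  assumes "e \<in> idempotents" "f \<in> idempotents"
  shows "e * f \<in> idempotents"
proof -
  define x where "x = star (e * f)"
  have x: "(e * f) * x * (e * f) = e * f" "x * (e * f) * x = x"
    unfolding x_def by (rule star_inverse)+
  note e = idempotentsD[OF assms(1)] idempotent_left[OF assms(1)]
  note f = idempotentsD[OF assms(2)] idempotent_left[OF assms(2)]
  have "x = f * x * e"
    unfolding x_def
  proof (rule star_unique, unfold x_def[symmetric])
    show "e * f * (f * x * e) * (e * f) = e * f"
      using x(1) by (simp add: mult.assoc e f)
    have "f * x * e * (e * f) * (f * x * e) = f * (x * (e * f) * x) * e"
      by (simp add: mult.assoc e f)
    then show "f * x * e * (e * f) * (f * x * e) = f * x * e"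
      by (simp add: x(2))
  qed
  moreover have "(f * x * e) * (f * x * e) = f * (x * (e * f) * x) * e"
    by (simp add: mult.assoc)
  ultimately have "x * x = x"
    using x(2) by metis
  then have "star x = x"
    by (simp add: star_idempotent idempotents_def)
  then have "e * f = x"
    unfolding x_def by simp
  with \<open>x * x = x\<close> show ?thesis
    by (simp add: idempotents_def)
qed

text \<open>Both e * f and f * e are inverses of the idempotent e * f.\<close>

lemma idempotents_commute:
  fixes e f :: "'s::inverse_semigroup"
  assumes "e \<in> idempotents" "f \<in> idempotents"
  shows "e * f = f * e"
proof -
  note e = idempotentsD[OF assms(1)] idempotent_left[OF assms(1)]
  note f = idempotentsD[OF assms(2)] idempotent_left[OF assms(2)]
  have ef: "e * f \<in> idempotents" and fe: "f * e \<in> idempotents"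
    using assms by (auto intro: idempotent_mult_idempotent)
  have "star (e * f) = f * e"
  proof (rule star_unique)
    show "e * f * (f * e) * (e * f) = e * f"
      using idempotentsD[OF ef] by (simp add: mult.assoc e f)
    show "f * e * (e * f) * (f * e) = f * e"
      using idempotentsD[OF fe] by (simp add: mult.assoc e f)
  qed
  with star_idempotent[OF ef] show ?thesis by simp
qed

lemma star_mult_self_idempotent [simp]: "star s * s \<in> idempotents"
  using star_inverse[of s] by (simp add: idempotents_def flip: mult.assoc)

lemma self_mult_star_idempotent [simp]: "s * star s \<in> idempotents"
  using star_inverse[of s] by (simp add: idempotents_def flip: mult.assoc)

lemma zero_idempotent [simp]: "0 \<in> idempotents"
  by (simp add: idempotents_def)

text \<open>The inverse laws for the product reduce to those of s and t once the idempotents t *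
  star t and star s * s are interchanged.\<close>

lemma star_mult: "star (s * t) = star t * star (s :: 's::inverse_semigroup)"
proof (rule star_unique)
  have comm: "(t * star t) * (star s * s) = (star s * s) * (t * star t)"
    by (rule idempotents_commute) simp_all
  have "s * t * (star t * star s) * (s * t) = s * ((t * star t) * (star s * s)) * t"
    by (simp add: mult.assoc)
  also have "\<dots> = (s * star s * s) * (t * star t * t)"
    unfolding comm by (simp add: mult.assoc)
  finally show "s * t * (star t * star s) * (s * t) = s * t"
    by (simp add: star_inverse)
  have "star t * star s * (s * t) * (star t * star s) = star t * ((star s * s) * (t * star t)) * star s"
    by (simp add: mult.assoc)
  also have "\<dots> = (star t * t * star t) * (star s * s * star s)"
    unfolding comm[symmetric] by (simp add: mult.assoc)
  finally show "star t * star s * (s * t) * (star t * star s) = star t * star s"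
    by (simp add: star_inverse)
qed

text \<open>Moving an idempotent from the left of s to its right costs a conjugation. This is the
  rewriting step behind products of germs and the spectral action.\<close>

lemma mult_idempotent_swap:
  assumes "e \<in> idempotents"
  shows "e * s = s * (star s * e * s)"
proof -
  have "e * s = e * (s * star s) * s"
    by (simp add: mult.assoc star_inverse[unfolded mult.assoc])
  also have "\<dots> = (s * star s) * e * s"
    using idempotents_commute[OF assms, of "s * star s"] by simp
  finally show ?thesis
    by (simp add: mult.assoc)
qed

lemma conjugate_mult:
  assumes "e \<in> idempotents" "f \<in> idempotents"
  shows "star s * (e * f) * s = (star s * e * s) * (star s * f * s)"
  using mult_idempotent_swap[OF assms(2), of s] by (simp add: mult.assoc)

lemma conjugate_idempotent:
  assumes "e \<in> idempotents"
  shows "star s * e * s \<in> idempotents"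
  using conjugate_mult[OF assms assms, of s] assms by (simp add: idempotents_def)


section \<open>Characters and ultracharacters\<close>

lemma characterD:
  assumes "\<xi> \<in> characters"
  shows "e \<in> idempotents \<Longrightarrow> f \<in> idempotents \<Longrightarrow> \<xi> (e * f) \<longleftrightarrow> \<xi> e \<and> \<xi> f"
    and "\<exists>e\<in>idempotents. \<xi> e" and "\<not> \<xi> 0" and "\<xi> \<in> extensional idempotents"
  using assms by (auto simp: characters_def)

lemma character_eqI:
  assumes "\<xi> \<in> characters" "\<eta> \<in> characters" "\<And>e. e \<in> idempotents \<Longrightarrow> \<xi> e = \<eta> e"
  shows "\<xi> = \<eta>"
  by (rule extensionalityI[of _ idempotents]) (use assms characterD(4) in auto)

lemma character_proper_filter:
  assumes "\<xi> \<in> characters"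
  shows "proper_filter {e \<in> idempotents. \<xi> e}"
  using characterD[OF assms]
  by (auto simp: proper_filter_def idem_le_def idempotent_mult_idempotent) metis

text \<open>Maximality is refuted by enlarging a filter. This is the filter generated by e and the
  idempotents on which \<xi> holds; the assumption on e keeps 0 out of it.\<close>

lemma proper_filter_upward_closure:
  fixes \<xi> :: "'s::inverse_semigroup \<Rightarrow> bool"
  assumes \<xi>: "\<xi> \<in> characters" and e: "e \<in> idempotents"
    and ne: "\<And>f. f \<in> idempotents \<Longrightarrow> \<xi> f \<Longrightarrow> e * f \<noteq> 0"
  shows "proper_filter {g \<in> idempotents. \<exists>f\<in>idempotents. \<xi> f \<and> idem_le (e * f) g}"
proof -
  let ?F = "{g \<in> idempotents. \<exists>f\<in>idempotents. \<xi> f \<and> idem_le (e * f) g}"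
  obtain f where f: "f \<in> idempotents" "\<xi> f"
    using characterD(2)[OF \<xi>] by blast
  have "e * f \<in> ?F"
    using f e idempotentsD[of "e * f"] by (auto simp: idempotent_mult_idempotent idem_le_def)
  moreover have "0 \<notin> ?F"
    using ne by (auto simp: idem_le_def)
  moreover have "a * b \<in> ?F" if "a \<in> ?F" "b \<in> ?F" for a b
  proof -
    from that obtain g h where g: "g \<in> idempotents" "\<xi> g" "e * g * a = e * g"
      and h: "h \<in> idempotents" "\<xi> h" "e * h * b = e * h"
      and ab: "a \<in> idempotents" "b \<in> idempotents"
      by (auto simp: idem_le_def)
    have gh: "e * (g * h) = (e * g) * h" "e * (g * h) = g * (e * h)"
      using idempotents_commute[OF e g(1)] by (simp_all add: mult.assoc[symmetric])
    have "e * (g * h) * (a * b) = (e * g) * (h * a) * b"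
      by (simp add: mult.assoc)
    also have "\<dots> = (e * g * a) * h * b"
      using idempotents_commute[OF h(1) ab(1)] by (simp add: mult.assoc)
    also have "\<dots> = g * (e * h * b)"
      using g(3) gh by (simp add: mult.assoc)
    also have "\<dots> = e * (g * h)"
      using h(3) gh by simp
    finally have "idem_le (e * (g * h)) (a * b)"
      by (simp add: idem_le_def)
    then show ?thesis
      using g h ab characterD(1)[OF \<xi> g(1) h(1)] by (auto simp: idempotent_mult_idempotent)
  qed
  moreover have "b \<in> ?F" if "a \<in> ?F" "b \<in> idempotents" "idem_le a b" for a b
    using that by (auto simp: idem_le_def) (metis mult.assoc)
  ultimately show ?thesis
    unfolding proper_filter_def by blast
qed

text \<open>If no f with \<xi> f is orthogonal to e, then e and \<xi> generate a proper filter that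
  is strictly larger. Conversely, a proper filter above \<xi> that contained such an e would contain
  e * f = 0. This criterion replaces quantification over filters in all that follows.\<close>

lemma ultracharacters_iff:
  fixes \<xi> :: "'s::inverse_semigroup \<Rightarrow> bool"
  shows "\<xi> \<in> ultracharacters \<longleftrightarrow> \<xi> \<in> characters \<and>
    (\<forall>e\<in>idempotents. \<not> \<xi> e \<longrightarrow> (\<exists>f\<in>idempotents. \<xi> f \<and> e * f = 0))"
proof (intro iffI conjI ballI impI)
  assume "\<xi> \<in> ultracharacters"
  then show \<xi>: "\<xi> \<in> characters"
    by (simp add: ultracharacters_def)
  fix e :: 's
  assume e: "e \<in> idempotents" "\<not> \<xi> e"
  show "\<exists>f\<in>idempotents. \<xi> f \<and> e * f = 0"
  proof (rule ccontr)
    let ?F = "{g \<in> idempotents. \<exists>f\<in>idempotents. \<xi> f \<and> idem_le (e * f) g}"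
    assume "\<not> ?thesis"
    then have "proper_filter ?F"
      using proper_filter_upward_closure[OF \<xi> e(1)] by blast
    moreover have "{f \<in> idempotents. \<xi> f} \<subseteq> ?F"
      by (auto simp: idem_le_def mult.assoc idempotentsD)
    ultimately have "?F = {f \<in> idempotents. \<xi> f}"
      using \<open>\<xi> \<in> ultracharacters\<close> by (auto simp: ultracharacters_def)
    moreover obtain f where f: "f \<in> idempotents" "\<xi> f"
      using characterD(2)[OF \<xi>] by blast
    moreover have "e * f * e = e * f"
      using idempotents_commute[OF f(1) e(1)] idempotent_left[OF e(1)] by (simp add: mult.assoc)
    ultimately show False
      using e by (auto simp: idem_le_def)
  qed
next
  assume *: "\<xi> \<in> characters \<and>
    (\<forall>e\<in>idempotents. \<not> \<xi> e \<longrightarrow> (\<exists>f\<in>idempotents. \<xi> f \<and> e * f = 0))"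
  have "F = {e \<in> idempotents. \<xi> e}"
    if F: "proper_filter F" "{e \<in> idempotents. \<xi> e} \<subseteq> F" for F
  proof -
    have "\<xi> e" if "e \<in> F" for e
    proof (rule ccontr)
      assume "\<not> \<xi> e"
      moreover have "e \<in> idempotents"
        using F(1) \<open>e \<in> F\<close> unfolding proper_filter_def by blast
      ultimately obtain f where f: "f \<in> idempotents" "\<xi> f" "e * f = 0"
        using * by blast
      then have "e * f \<in> F"
        using F \<open>e \<in> F\<close> unfolding proper_filter_def by blast
      then show False
        using f(3) F(1) unfolding proper_filter_def by simp
    qed
    then show ?thesis
      using F by (auto simp: proper_filter_def)
  qed
  then show "\<xi> \<in> ultracharacters"
    using * by (simp add: ultracharacters_def character_proper_filter)
qed

lemma ultracharacters_subset: "ultracharacters \<subseteq> characters"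
  by (auto simp: ultracharacters_def)

section \<open>Existence of ultracharacters through a nonzero idempotent\<close>

lemma principal_proper_filter:
  fixes e :: "'s::inverse_semigroup"
  assumes "e \<in> idempotents" "e \<noteq> 0"
  shows "proper_filter {f \<in> idempotents. idem_le e f}"
  using assms unfolding proper_filter_def idem_le_def
  by (auto simp: idempotent_mult_idempotent idempotentsD simp flip: mult.assoc)
    (metis mult.assoc)

lemma proper_filter_Union_chain:
  assumes C: "subset.chain {F. proper_filter F} C" "C \<noteq> {}"
  shows "proper_filter (\<Union>C)"
proof -
  have pf: "proper_filter F" if "F \<in> C" for F
    using C that by (auto simp: subset.chain_def)
  have "a * b \<in> \<Union>C" if "a \<in> \<Union>C" "b \<in> \<Union>C" for a b
  proof -
    from that obtain F G where FG: "F \<in> C" "G \<in> C" "a \<in> F" "b \<in> G"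
      by blast
    then have "F \<subseteq> G \<or> G \<subseteq> F"
      using C by (auto simp: subset_chain_def)
    then show ?thesis
      using FG pf[of F] pf[of G] unfolding proper_filter_def by blast
  qed
  moreover have "\<Union>C \<noteq> {}"
    using C(2) pf unfolding proper_filter_def by blast
  moreover have "\<Union>C \<subseteq> idempotents" "0 \<notin> \<Union>C"
    using pf unfolding proper_filter_def by blast+
  moreover have "b \<in> \<Union>C" if "a \<in> \<Union>C" "b \<in> idempotents" "idem_le a b" for a b
    using pf that unfolding proper_filter_def by blast
  ultimately show ?thesis
    unfolding proper_filter_def by blast
qed

text \<open>Zorn's lemma applies to the proper filters through e; the principal one exists because e
  is nonzero. A filter maximal among these is maximal among all proper filters, since anything
  larger still contains e.\<close>

lemma ultracharacter_exists:
  fixes e :: "'s::inverse_semigroup"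
  assumes e: "e \<in> idempotents" "e \<noteq> 0"
  shows "\<exists>\<xi>\<in>ultracharacters. \<xi> e"
proof -
  let ?A = "{F. proper_filter F \<and> e \<in> F}"
  have "\<exists>M\<in>?A. \<forall>F\<in>?A. M \<subseteq> F \<longrightarrow> F = M"
  proof (rule subset_Zorn_nonempty)
    have "e \<in> {f \<in> idempotents. idem_le e f}"
      using e by (simp add: idem_le_def idempotentsD)
    then show "?A \<noteq> {}"
      using principal_proper_filter[OF e] by blast
    fix C
    assume C: "C \<noteq> {}" "subset.chain ?A C"
    then have "subset.chain {F. proper_filter F} C"
      by (auto simp: subset_chain_def)
    then show "\<Union>C \<in> ?A"
      using C proper_filter_Union_chain[of C] by (auto simp: subset_chain_def)
  qed
  then obtain M where M: "proper_filter M" "e \<in> M"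
    and max: "\<And>F. proper_filter F \<Longrightarrow> M \<subseteq> F \<Longrightarrow> F = M"
    by blast
  define \<xi> where "\<xi> = (\<lambda>f\<in>idempotents. f \<in> M)"
  \<comment> \<open>Upward closure supplies the direction from left to right, because a * b lies
    below both a and b. This makes the indicator function of a filter multiplicative.\<close>
  have ab: "a * b \<in> M \<longleftrightarrow> a \<in> M \<and> b \<in> M" if "a \<in> idempotents" "b \<in> idempotents" for a b
  proof -
    have "a * b * a = a * b" "a * b * b = a * b"
      using idempotents_commute[OF that] that by (simp_all add: mult.assoc idempotentsD idempotent_left)
    then show ?thesis
      using M(1) that unfolding proper_filter_def idem_le_def by metis
  qed
  have sub: "{f \<in> idempotents. \<xi> f} = M"
    using M by (auto simp: \<xi>_def proper_filter_def)
  have "\<xi> \<in> characters"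
    unfolding characters_def
  proof (intro CollectI conjI ballI)
    show "\<exists>e\<in>idempotents. \<xi> e"
      using M e by (auto simp: \<xi>_def)
    show "\<not> \<xi> 0"
      using M(1) by (simp add: \<xi>_def proper_filter_def)
    show "\<xi> (a * b) = (\<xi> a \<and> \<xi> b)" if "a \<in> idempotents" "b \<in> idempotents" for a b
      using ab[OF that] that by (simp add: \<xi>_def idempotent_mult_idempotent)
  qed (simp add: \<xi>_def)
  then have "\<xi> \<in> ultracharacters"
    using M max by (simp add: ultracharacters_def sub)
  moreover have "\<xi> e"
    using M e by (simp add: \<xi>_def)
  ultimately show ?thesis by blast
qed


section \<open>The character space\<close>

lemma topspace_character_space [simp]: "topspace character_space = characters"
  by (auto simp: character_space_def characters_def PiE_UNIV_domain extensional_def)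

lemma topspace_ultra_space [simp]: "topspace ultra_space = ultracharacters"
  using ultracharacters_subset by (auto simp: ultra_space_def)

lemma Hausdorff_character_space: "Hausdorff_space character_space"
  by (simp add: character_space_def Hausdorff_space_subtopology Hausdorff_space_product_topology)

lemma Hausdorff_ultra_space: "Hausdorff_space ultra_space"
  by (simp add: ultra_space_def Hausdorff_character_space Hausdorff_space_subtopology)

lemma ultra_space_eq:
  "ultra_space = subtopology (product_topology (\<lambda>_. discrete_topology UNIV) idempotents) ultracharacters"
  by (simp add: ultra_space_def character_space_def subtopology_subtopology
      Int_absorb1[OF ultracharacters_subset])

lemma continuous_map_evaluation:
  assumes "e \<in> idempotents"
  shows "continuous_map ultra_space (discrete_topology UNIV) (\<lambda>\<xi>. \<xi> e)"
  unfolding ultra_space_eq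
  by (intro continuous_map_from_subtopology continuous_map_product_projection assms)

lemma continuous_map_into_ultra_space:
  assumes "\<And>e. e \<in> idempotents \<Longrightarrow> continuous_map X (discrete_topology UNIV) (\<lambda>x. f x e)"
    and "f \<in> topspace X \<rightarrow> ultracharacters"
  shows "continuous_map X ultra_space f"
  unfolding ultra_space_eq continuous_map_in_subtopology continuous_map_componentwise
  using assms ultracharacters_subset by (auto simp: characters_def)

lemma clopen_evaluation:
  assumes "e \<in> idempotents"
  shows "openin ultra_space {\<xi> \<in> ultracharacters. \<xi> e}"
    and "closedin ultra_space {\<xi> \<in> ultracharacters. \<xi> e}"
  using openin_continuous_map_preimage[OF continuous_map_evaluation[OF assms], of "{True}"]
    closedin_continuous_map_preimage[OF continuous_map_evaluation[OF assms], of "{True}"]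
  by simp_all

text \<open>For an ultracharacter \<open>\<xi>\<close>, a condition \<open>\<not> \<xi> f\<close> is implied by a positive one, namely by
  \<open>\<xi> e\<close> for some \<open>e\<close> orthogonal to \<open>f\<close>; so the positive conditions alone give a basis.\<close>

lemma ultracharacter_determined_on_finite:
  assumes \<xi>: "\<xi> \<in> ultracharacters" and J: "finite J" "J \<subseteq> idempotents"
  shows "\<exists>e\<in>idempotents. \<xi> e \<and> (\<forall>\<eta>\<in>ultracharacters. \<eta> e \<longrightarrow> (\<forall>i\<in>J. \<eta> i = \<xi> i))"
  using J
proof (induction J rule: finite_induct)
  case empty
  then show ?case
    using \<xi> characterD(2)[of \<xi>] by (auto simp: ultracharacters_iff)
next
  case (insert i J)
  then have "\<exists>e\<in>idempotents. \<xi> e \<and> (\<forall>\<eta>\<in>ultracharacters. \<eta> e \<longrightarrow> (\<forall>i\<in>J. \<eta> i = \<xi> i))"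
    by simp
  then obtain e where e: "e \<in> idempotents" "\<xi> e"
    "\<And>\<eta>. \<eta> \<in> ultracharacters \<Longrightarrow> \<eta> e \<Longrightarrow> \<forall>i\<in>J. \<eta> i = \<xi> i"
    by meson
  have i: "i \<in> idempotents"
    using insert by simp
  have "\<exists>f\<in>idempotents. \<xi> f \<and> (\<forall>\<eta>\<in>ultracharacters. \<eta> f \<longrightarrow> \<eta> i = \<xi> i)"
  proof (cases "\<xi> i")
    case True
    then show ?thesis using i by blast
  next
    case False
    then obtain f where f: "f \<in> idempotents" "\<xi> f" "i * f = 0"
      using \<xi> i by (auto simp: ultracharacters_iff)
    have "\<eta> i = \<xi> i" if "\<eta> \<in> ultracharacters" "\<eta> f" for \<eta>
      using that False f i characterD(1)[of \<eta> i f] characterD(3)[of \<eta>] ultracharacters_subset by auto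
    then show ?thesis using f by blast
  qed
  then obtain f where f: "f \<in> idempotents" "\<xi> f"
    "\<And>\<eta>. \<eta> \<in> ultracharacters \<Longrightarrow> \<eta> f \<Longrightarrow> \<eta> i = \<xi> i"
    by meson
  have ef: "\<eta> (e * f) \<longleftrightarrow> \<eta> e \<and> \<eta> f" if "\<eta> \<in> ultracharacters" for \<eta>
    using that e(1) f(1) characterD(1)[of \<eta> e f] ultracharacters_subset by blast
  show ?case
  proof (intro bexI[of _ "e * f"] conjI ballI impI)
    show "e * f \<in> idempotents" "\<xi> (e * f)"
      using e(1,2) f(1,2) ef[OF \<xi>] by (simp_all add: idempotent_mult_idempotent)
    fix \<eta> j assume \<eta>: "\<eta> \<in> ultracharacters" "\<eta> (e * f)" and "j \<in> insert i J"
    then show "\<eta> j = \<xi> j"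
      using ef[OF \<eta>(1)] e(3)[OF \<eta>(1)] f(3)[OF \<eta>(1)] by blast
  qed
qed

text \<open>A basic open set of the product restricts only finitely many coordinates, and a single
  idempotent pins all of these to their values at \<xi>.\<close>

lemma ultra_space_basis:
  assumes "openin ultra_space U" "\<xi> \<in> U"
  shows "\<exists>e\<in>idempotents. \<xi> e \<and> {\<eta> \<in> ultracharacters. \<eta> e} \<subseteq> U"
proof -
  obtain T where T: "openin (product_topology (\<lambda>_. discrete_topology UNIV) idempotents) T"
    "U = T \<inter> ultracharacters"
    using assms(1) unfolding ultra_space_eq openin_subtopology by blast
  have "\<xi> \<in> T" and \<xi>: "\<xi> \<in> ultracharacters"
    using T assms(2) by auto
  then obtain V where V: "finite {i \<in> idempotents. V i \<noteq> UNIV}"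
    "\<xi> \<in> Pi\<^sub>E idempotents V" "Pi\<^sub>E idempotents V \<subseteq> T"
    using T(1) unfolding openin_product_topology_alt topspace_discrete_topology by meson
  have "{i \<in> idempotents. V i \<noteq> UNIV} \<subseteq> idempotents"
    by simp
  from ultracharacter_determined_on_finite[OF \<xi> V(1) this]
  obtain e where e: "e \<in> idempotents" "\<xi> e"
    "\<And>\<eta>. \<eta> \<in> ultracharacters \<Longrightarrow> \<eta> e \<Longrightarrow> \<forall>i\<in>{i \<in> idempotents. V i \<noteq> UNIV}. \<eta> i = \<xi> i"
    by meson
  have "\<eta> \<in> U" if \<eta>: "\<eta> \<in> ultracharacters" "\<eta> e" for \<eta>
  proof -
    have "\<eta> i \<in> V i" if "i \<in> idempotents" for i
      using e(3)[OF \<eta>] V(2) that by (cases "V i = UNIV") (auto simp: PiE_iff)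
    moreover have "\<eta> \<in> extensional idempotents"
      using \<eta> characterD(4) ultracharacters_subset by blast
    ultimately have "\<eta> \<in> Pi\<^sub>E idempotents V"
      by (simp add: PiE_iff)
    then have "\<eta> \<in> T"
      using V(3) by blast
    then show ?thesis
      using T \<eta> by blast
  qed
  with e show ?thesis by blast
qed

section \<open>Compactness and closedness of the set of ultracharacters\<close>

lemma tight_eq_ultra_if_compact:
  assumes "compact_space (ultra_space :: ('s::inverse_semigroup \<Rightarrow> bool) topology)"
  shows "(tight_characters :: ('s \<Rightarrow> bool) set) = ultracharacters"
proof -
  have "compactin character_space (ultracharacters :: ('s \<Rightarrow> bool) set)"
    using assms ultracharacters_subset by (simp add: compactin_subspace ultra_space_def)
  then have "closedin character_space (ultracharacters :: ('s \<Rightarrow> bool) set)"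
    using Hausdorff_character_space compactin_imp_closedin by blast
  then show ?thesis
    by (simp add: tight_characters_def closure_of_closedin)
qed

text \<open>The characters form a closed subset of the compact product of two-point spaces. Being
  nonzero is an existential and only gives an open condition; with a unit u it amounts to \<xi> u,
  which is closed.\<close>

lemma compact_character_space:
  assumes "has_unit TYPE('s::inverse_semigroup)"
  shows "compact_space (character_space :: ('s \<Rightarrow> bool) topology)"
proof -
  let ?P = "product_topology (\<lambda>_. discrete_topology (UNIV :: bool set)) (idempotents :: 's set)"
  obtain u :: 's where u: "\<And>s. u * s = s" "\<And>s. s * u = s"
    using assms by (auto simp: has_unit_def)
  have u': "u \<in> idempotents"
    by (simp add: idempotents_def u)
  have ev: "closedin ?P {\<xi> \<in> topspace ?P. \<xi> e \<in> A}" if "e \<in> idempotents" for e A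
    using that
    by (intro closedin_continuous_map_preimage[of _ "discrete_topology UNIV"]
      continuous_map_product_projection) simp_all
  have ev2: "closedin ?P {\<xi> \<in> topspace ?P. \<xi> (e * f) = (\<xi> e \<and> \<xi> f)}"
    if "e \<in> idempotents" "f \<in> idempotents" for e f
  proof -
    \<comment> \<open>The truth table of the equation is spelled out so that the set becomes a
      finite combination of preimages under single coordinates.\<close>
    have "{\<xi> \<in> topspace ?P. \<xi> (e * f) = (\<xi> e \<and> \<xi> f)} =
      ({\<xi> \<in> topspace ?P. \<xi> (e * f) \<in> {True}} \<inter>
        ({\<xi> \<in> topspace ?P. \<xi> e \<in> {True}} \<inter> {\<xi> \<in> topspace ?P. \<xi> f \<in> {True}})) \<union>
      ({\<xi> \<in> topspace ?P. \<xi> (e * f) \<in> {False}} \<inter>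
        ({\<xi> \<in> topspace ?P. \<xi> e \<in> {False}} \<union> {\<xi> \<in> topspace ?P. \<xi> f \<in> {False}}))"
      by auto
    then show ?thesis
      using that idempotent_mult_idempotent[OF that]
      by (simp only:) (intro closedin_Un closedin_Int ev)
  qed
  have "characters = (\<Inter>(e, f) \<in> idempotents \<times> idempotents.
      {\<xi> \<in> topspace ?P. \<xi> (e * f) = (\<xi> e \<and> \<xi> f)}) \<inter>
      ({\<xi> \<in> topspace ?P. \<xi> u \<in> {True}} \<inter> {\<xi> \<in> topspace ?P. \<xi> 0 \<in> {False}})" (is "_ = ?R")
  proof (intro equalityI subsetI)
    fix \<xi> :: "'s \<Rightarrow> bool"
    assume \<xi>: "\<xi> \<in> characters"
    \<comment> \<open>Some \<xi> e holds, and e = e * u.\<close>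
    then have "\<xi> u"
      using characterD(1)[OF \<xi> u'] characterD(2)[OF \<xi>] u by metis
    moreover have "\<xi> \<in> topspace ?P"
      using characterD(4)[OF \<xi>] by (simp add: PiE_iff)
    ultimately show "\<xi> \<in> ?R"
      using characterD(1,3)[OF \<xi>] by (simp del: topspace_product_topology)
  next
    fix \<xi> :: "'s \<Rightarrow> bool"
    assume "\<xi> \<in> ?R"
    then show "\<xi> \<in> characters"
      using u' by (auto simp: characters_def PiE_iff)
  qed
  also have "closedin ?P \<dots>"
    using u' by (intro closedin_Int closedin_INT ev) (auto intro: ev2 simp del: topspace_product_topology)
  finally have "compactin ?P (characters :: ('s \<Rightarrow> bool) set)"
    by (intro closedin_compact_space) (auto simp: compact_space_product_topology compact_space_discrete_topology)
  then show ?thesis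
    by (simp add: character_space_def compactin_subspace)
qed

lemma compact_ultra_space_if_tight_eq_ultra:
  assumes "has_unit TYPE('s::inverse_semigroup)"
    and eq: "(tight_characters :: ('s \<Rightarrow> bool) set) = ultracharacters"
  shows "compact_space (ultra_space :: ('s \<Rightarrow> bool) topology)"
proof -
  have "closedin character_space (ultracharacters :: ('s \<Rightarrow> bool) set)"
    using eq by (metis tight_characters_def closedin_closure_of)
  then have "compactin character_space (ultracharacters :: ('s \<Rightarrow> bool) set)"
    using closedin_compact_space compact_character_space[OF assms(1)] by blast
  then show ?thesis
    by (simp add: ultra_space_def compactin_subspace)
qed


section \<open>Actions and their germs\<close>

lemma action_partial_homeo:
  assumes "action X \<alpha>"
  shows "openin X (dom (\<alpha> s))" "inj_on (the \<circ> \<alpha> s) (dom (\<alpha> s))"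
    and "\<alpha> s x = Some y \<Longrightarrow> x \<in> topspace X \<and> y \<in> topspace X"
proof -
  have s: "openin X (dom (\<alpha> s))" "openin X (ran (\<alpha> s))"
    "homeomorphic_map (subtopology X (dom (\<alpha> s))) (subtopology X (ran (\<alpha> s))) (the \<circ> \<alpha> s)"
    using assms by (auto simp: action_def partial_homeos_def)
  then show "openin X (dom (\<alpha> s))" by simp
  have d: "topspace X \<inter> dom (\<alpha> s) = dom (\<alpha> s)"
    using openin_subset[OF s(1)] by blast
  show "inj_on (the \<circ> \<alpha> s) (dom (\<alpha> s))"
    using homeomorphic_imp_injective_map[OF s(3)] unfolding topspace_subtopology d .
  show "\<alpha> s x = Some y \<Longrightarrow> x \<in> topspace X \<and> y \<in> topspace X"
    using openin_subset[OF s(1)] openin_subset[OF s(2)] by (auto intro: ranI domI)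
qed

lemma action_inject:
  assumes "action X \<alpha>" "\<alpha> s x = Some z" "\<alpha> s y = Some z"
  shows "x = y"
  using action_partial_homeo(2)[OF assms(1), of s] assms(2,3) by (auto simp: inj_on_def dom_def)

lemma action_mult:
  assumes "action X \<alpha>"
  shows "\<alpha> (s * t) x = Some z \<longleftrightarrow> (\<exists>y. \<alpha> t x = Some y \<and> \<alpha> s y = Some z)"
  using assms by (simp add: action_def map_comp_Some_iff)

text \<open>Idempotency yields \<alpha> e y = Some y, so x and y have the same image and injectivity
  applies.\<close>

lemma action_idempotent:
  assumes "action X \<alpha>" "e \<in> idempotents" "\<alpha> e x = Some y"
  shows "y = x"
  using assms(3) action_mult[OF assms(1), of e e x y] action_inject[OF assms(1), of e x y y]
  by (simp add: idempotentsD[OF assms(2)])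

lemma action_idempotent_dom:
  assumes "action X \<alpha>" "e \<in> idempotents"
  shows "x \<in> dom (\<alpha> e) \<longleftrightarrow> \<alpha> e x = Some x"
  using action_idempotent[OF assms] by blast

lemma action_dom_mult:
  assumes "action X \<alpha>" "e \<in> idempotents" "f \<in> idempotents"
  shows "dom (\<alpha> (e * f)) = dom (\<alpha> e) \<inter> dom (\<alpha> f)"
proof -
  have "x \<in> dom (\<alpha> (e * f)) \<longleftrightarrow> x \<in> dom (\<alpha> e) \<inter> dom (\<alpha> f)" for x
    using action_idempotent[OF assms(1,3)] action_mult[OF assms(1), of e f x]
    by (auto simp: dom_def)
  then show ?thesis by blast
qed

text \<open>Since s = s * (star s * s), the idempotent star s * s must be defined at x, where it can
  only act as the identity; hence star s undoes s.\<close>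

lemma action_star:
  assumes "action X \<alpha>" "\<alpha> s x = Some y"
  shows "\<alpha> (star s * s) x = Some x" "\<alpha> (star s) y = Some x"
proof -
  have "\<alpha> (s * (star s * s)) x = Some y"
    using assms(2) star_inverse(1)[of s] by (simp add: mult.assoc)
  then obtain z where "\<alpha> (star s * s) x = Some z"
    unfolding action_mult[OF assms(1), of s "star s * s"] by blast
  then show *: "\<alpha> (star s * s) x = Some x"
    using action_idempotent[OF assms(1) star_mult_self_idempotent] by metis
  then show "\<alpha> (star s) y = Some x"
    using assms(2) unfolding action_mult[OF assms(1), of "star s" s] by auto
qed

lemma action_star_dom:
  assumes "action X \<alpha>"
  shows "dom (\<alpha> (star s * s)) = dom (\<alpha> s)"
  using action_star(1)[OF assms, of s] action_mult[OF assms, of "star s" s]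
  by (auto simp: dom_def)

text \<open>Conjugation of an idempotent by s is pullback of its domain along \<alpha> s. On the
  level of point characters this is equivariance, and in the groupoid it transports witnesses of
  equal germs from y to x.\<close>

lemma action_conjugate_dom:
  assumes "action X \<alpha>" "e \<in> idempotents" "\<alpha> s x = Some y"
  shows "x \<in> dom (\<alpha> (star s * e * s)) \<longleftrightarrow> y \<in> dom (\<alpha> e)"
proof -
  have "\<alpha> (star s * e * s) x = Some z \<longleftrightarrow> \<alpha> e y = Some y \<and> z = x" for z
    using action_star(2)[OF assms(1,3)] assms(3) action_idempotent[OF assms(1,2), of y]
    by (auto simp: action_mult[OF assms(1)])
  then show ?thesis
    using action_idempotent_dom[OF assms(1,2)] by (auto simp: dom_def)
qed

section \<open>Equality of germs\<close>

lemma mem_germ: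
  assumes "action X \<alpha>"
  shows "(t, y) \<in> germ \<alpha> s x \<longleftrightarrow> y = x \<and> x \<in> dom (\<alpha> s) \<and> x \<in> dom (\<alpha> t) \<and>
    (\<exists>e\<in>idempotents. x \<in> dom (\<alpha> e) \<and> s * e = t * e)"
  unfolding germ_def germ_rel_def using action_star_dom[OF assms] by auto

lemma germ_self:
  assumes "action X \<alpha>" "x \<in> dom (\<alpha> s)"
  shows "(s, x) \<in> germ \<alpha> s x"
  unfolding mem_germ[OF assms(1)]
  using assms(2) action_star_dom[OF assms(1), of s] star_mult_self_idempotent[of s] by blast

lemma germ_eq_iff:
  assumes A: "action X \<alpha>" and x: "x \<in> dom (\<alpha> s)"
  shows "germ \<alpha> s x = germ \<alpha> t y \<longleftrightarrow> y = x \<and> x \<in> dom (\<alpha> t) \<and>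
    (\<exists>e\<in>idempotents. x \<in> dom (\<alpha> e) \<and> s * e = t * e)"
proof
  assume "germ \<alpha> s x = germ \<alpha> t y"
  then have "(s, x) \<in> germ \<alpha> t y"
    using germ_self[OF A x] by simp
  then show "y = x \<and> x \<in> dom (\<alpha> t) \<and> (\<exists>e\<in>idempotents. x \<in> dom (\<alpha> e) \<and> s * e = t * e)"
    unfolding mem_germ[OF A] by metis
next
  \<comment> \<open>Transitivity of the germ relation: the product of the two witnesses is a witness
    for t and r, because idempotents commute.\<close>
  have *: "(\<exists>f\<in>idempotents. x \<in> dom (\<alpha> f) \<and> t * f = r * f)"
    if "e \<in> idempotents" "x \<in> dom (\<alpha> e)" "s * e = t * e"
      "f \<in> idempotents" "x \<in> dom (\<alpha> f)" "s * f = r * f" for s t r e f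
  proof (intro bexI[of _ "e * f"] conjI)
    show "x \<in> dom (\<alpha> (e * f))" "e * f \<in> idempotents"
      using that by (auto simp: action_dom_mult[OF A] idempotent_mult_idempotent)
    have "t * (e * f) = s * f * e"
      using that(3) idempotents_commute[OF that(1,4)] by (metis mult.assoc)
    then show "t * (e * f) = r * (e * f)"
      using that(6) idempotents_commute[OF that(1,4)] by (metis mult.assoc)
  qed
  assume "y = x \<and> x \<in> dom (\<alpha> t) \<and> (\<exists>e\<in>idempotents. x \<in> dom (\<alpha> e) \<and> s * e = t * e)"
  then obtain e where e: "y = x" "x \<in> dom (\<alpha> t)" "e \<in> idempotents" "x \<in> dom (\<alpha> e)" "s * e = t * e"
    by blast
  have "(r, z) \<in> germ \<alpha> s x \<longleftrightarrow> (r, z) \<in> germ \<alpha> t y" for r z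
    unfolding mem_germ[OF A] using e x *[of e s t _ r] *[of e t s _ r] by metis
  then show "germ \<alpha> s x = germ \<alpha> t y"
    by auto
qed

section \<open>The arrow space and the groupoid operations on representatives\<close>

abbreviation arrow_basis ::
    "'x topology \<Rightarrow> ('s::inverse_semigroup \<Rightarrow> 'x \<rightharpoonup> 'x) \<Rightarrow> ('s \<times> 'x) set set set" where
  "arrow_basis X \<alpha> \<equiv> {germ \<alpha> s ` U | s U. openin X U \<and> U \<subseteq> dom (\<alpha> (star s * s))}"

lemma arrows_germ_groupoid:
  "arrows (germ_groupoid X \<alpha>) = topology_generated_by (arrow_basis X \<alpha>)"
  by (simp add: germ_groupoid_def)

lemma units_germ_groupoid [simp]: "units (germ_groupoid X \<alpha>) = X"
  by (simp add: germ_groupoid_def)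

lemma topspace_arrows:
  assumes "action X \<alpha>"
  shows "topspace (arrows (germ_groupoid X \<alpha>)) = {germ \<alpha> s x | s x. x \<in> dom (\<alpha> s)}"
  unfolding arrows_germ_groupoid topology_generated_by_topspace action_star_dom[OF assms]
proof (intro equalityI subsetI)
  fix g assume "g \<in> {germ \<alpha> s x | s x. x \<in> dom (\<alpha> s)}"
  then obtain s x where "g \<in> germ \<alpha> s ` dom (\<alpha> s)"
    by blast
  then show "g \<in> \<Union>{germ \<alpha> s ` U | s U. openin X U \<and> U \<subseteq> dom (\<alpha> s)}"
    using action_partial_homeo(1)[OF assms, of s] by blast
qed blast

text \<open>The description has a unique value: for two idempotents e and f defined at x, the
  product e * f witnesses equality of their germs.\<close>

lemma unit_at_germ_groupoid:
  assumes A: "action X \<alpha>" and e: "e \<in> idempotents" "x \<in> dom (\<alpha> e)"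
  shows "unit_at (germ_groupoid X \<alpha>) x = germ \<alpha> e x"
proof -
  have "germ \<alpha> f x = germ \<alpha> e x" if "f \<in> idempotents" "x \<in> dom (\<alpha> f)" for f
    unfolding germ_eq_iff[OF A that(2)]
  proof (intro conjI bexI[of _ "e * f"])
    show "x \<in> dom (\<alpha> (e * f))" "e * f \<in> idempotents"
      using that e by (auto simp: action_dom_mult[OF A] idempotent_mult_idempotent)
    show "f * (e * f) = e * (e * f)"
      using idempotents_commute[OF e(1) that(1)] idempotent_left[OF e(1)] idempotent_left[OF that(1)]
      by metis
  qed (use e in auto)
  then show ?thesis
    unfolding germ_groupoid_def top_groupoid.simps using e by (intro the_equality) blast+
qed

lemma src_germ_groupoid:
  assumes A: "action X \<alpha>" and x: "x \<in> dom (\<alpha> s)"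
  shows "src (germ_groupoid X \<alpha>) (germ \<alpha> s x) = x"
  unfolding germ_groupoid_def top_groupoid.simps action_star_dom[OF A]
proof (rule the_equality)
  show "\<exists>t. x \<in> dom (\<alpha> t) \<and> germ \<alpha> s x = germ \<alpha> t x"
    using x by blast
  show "y = x" if "\<exists>t. y \<in> dom (\<alpha> t) \<and> germ \<alpha> s x = germ \<alpha> t y" for y
    using that germ_eq_iff[OF A x] by blast
qed

text \<open>On the domain of the witness e, multiplying by e on the right does not change the value
  at x. So the range of a germ does not depend on the representative.\<close>

lemma action_germ_eq:
  assumes A: "action X \<alpha>" and s: "x \<in> dom (\<alpha> s)" and eq: "germ \<alpha> s x = germ \<alpha> t y"
  shows "\<alpha> s x = \<alpha> t y"
proof -
  obtain e where e: "y = x" "x \<in> dom (\<alpha> t)" "e \<in> idempotents" "x \<in> dom (\<alpha> e)" "s * e = t * e"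
    using eq unfolding germ_eq_iff[OF A s] by blast
  have "\<alpha> (r * e) x = \<alpha> r x" for r
    using A e(4) action_idempotent_dom[OF A e(3)] by (simp add: action_def map_comp_simps)
  then show ?thesis
    using e by metis
qed

lemma rng_germ_groupoid:
  assumes A: "action X \<alpha>" and x: "\<alpha> s x = Some y"
  shows "rng (germ_groupoid X \<alpha>) (germ \<alpha> s x) = y"
proof -
  have xs: "x \<in> dom (\<alpha> s)" "y = the (\<alpha> s x)"
    using x by auto
  show ?thesis
    unfolding germ_groupoid_def top_groupoid.simps action_star_dom[OF A]
  proof (rule the_equality)
    show "\<exists>t x'. x' \<in> dom (\<alpha> t) \<and> germ \<alpha> s x = germ \<alpha> t x' \<and> y = the (\<alpha> t x')"
      using xs by blast
    show "y' = y" if "\<exists>t x'. x' \<in> dom (\<alpha> t) \<and> germ \<alpha> s x = germ \<alpha> t x' \<and> y' = the (\<alpha> t x')" for y'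
      using that xs action_germ_eq[OF A xs(1)] by metis
  qed
qed

lemma gcomp_germ_groupoid:
  assumes A: "action X \<alpha>" and t: "\<alpha> t x = Some y" and s: "y \<in> dom (\<alpha> s)"
  shows "gcomp (germ_groupoid X \<alpha>) (germ \<alpha> s y) (germ \<alpha> t x) = germ \<alpha> (s * t) x"
proof -
  have xt: "x \<in> dom (\<alpha> t)"
    using t by blast
  have xst: "x \<in> dom (\<alpha> (s * t))"
    using s t by (auto simp: action_mult[OF A] dom_def)
  have unique: "germ \<alpha> (s' * t') x' = germ \<alpha> (s * t) x"
    if s': "the (\<alpha> t' x') \<in> dom (\<alpha> s')" "germ \<alpha> s y = germ \<alpha> s' (the (\<alpha> t' x'))"
      and t': "germ \<alpha> t x = germ \<alpha> t' x'" for s' t' x'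
  proof -
    have [simp]: "x' = x"
      using t' germ_eq_iff[OF A xt] by blast
    have t'x: "\<alpha> t' x = Some y"
      using t' action_germ_eq[OF A xt] t by simp
    obtain e where e: "e \<in> idempotents" "y \<in> dom (\<alpha> e)" "s * e = s' * e"
      using s'(2) germ_eq_iff[OF A s] by blast
    obtain f where f: "f \<in> idempotents" "x \<in> dom (\<alpha> f)" "t * f = t' * f"
      using t' germ_eq_iff[OF A xt] by blast
    \<comment> \<open>The witness e for s and s' lives at y, whereas the product germ is based at x.
      Its pullback along t is defined at x and satisfies t * ?c = e * t, so f * ?c serves for both
      factors at once.\<close>
    let ?c = "star t * e * t"
    have c: "?c \<in> idempotents" "x \<in> dom (\<alpha> ?c)"
      using conjugate_idempotent[OF e(1)] action_conjugate_dom[OF A e(1) t] e(2) by auto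
    have r: "r * t * (f * ?c) = r * e * t * f" for r
    proof -
      have "r * t * (f * ?c) = r * (t * ?c) * f"
        unfolding idempotents_commute[OF f(1) c(1)] by (simp add: mult.assoc)
      then show ?thesis
        unfolding mult_idempotent_swap[OF e(1), of t, symmetric] by (simp add: mult.assoc)
    qed
    have "s * t * (f * ?c) = s' * t * (f * ?c)"
      unfolding r e(3) ..
    also have "\<dots> = s' * (t * f) * ?c"
      by (simp add: mult.assoc)
    also have "\<dots> = s' * t' * (f * ?c)"
      unfolding f(3) by (simp add: mult.assoc)
    finally have "s * t * (f * ?c) = s' * t' * (f * ?c)" .
    moreover have "f * ?c \<in> idempotents" "x \<in> dom (\<alpha> (f * ?c))"
      using c f by (simp_all add: idempotent_mult_idempotent action_dom_mult[OF A])
    moreover have "x \<in> dom (\<alpha> (s' * t'))"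
      using t'x s'(1) by (auto simp: action_mult[OF A] dom_def)
    ultimately have "germ \<alpha> (s * t) x = germ \<alpha> (s' * t') x"
      unfolding germ_eq_iff[OF A xst] by blast
    then show ?thesis by simp
  qed
  have y: "the (\<alpha> t x) = y"
    using t by simp
  show ?thesis
    unfolding germ_groupoid_def top_groupoid.simps action_star_dom[OF A]
    by (rule the_equality) (use s xt y unique in blast)+
qed

lemma ginv_germ_groupoid:
  assumes A: "action X \<alpha>" and s: "\<alpha> s x = Some y"
  shows "ginv (germ_groupoid X \<alpha>) (germ \<alpha> s x) = germ \<alpha> (star s) y"
proof -
  have xs: "x \<in> dom (\<alpha> s)"
    using s by blast
  have ys: "y \<in> dom (\<alpha> (star s))"
    using action_star(2)[OF A s] by blast
  have unique: "germ \<alpha> (star t) (the (\<alpha> t x')) = germ \<alpha> (star s) y"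
    if t: "germ \<alpha> s x = germ \<alpha> t x'" for t x'
  proof -
    have [simp]: "x' = x"
      using t germ_eq_iff[OF A xs] by blast
    have tx: "\<alpha> t x = Some y"
      using t action_germ_eq[OF A xs] s by simp
    obtain e where e: "e \<in> idempotents" "x \<in> dom (\<alpha> e)" "s * e = t * e"
      using t germ_eq_iff[OF A xs] by blast
    \<comment> \<open>Taking inverses turns the right-hand witness into a left-hand one. The germs
      of the inverses are based at y, and their witness will be s * e * star s, the domain of e
      pushed forward along s.\<close>
    have es: "e * star s = e * star t"
      using arg_cong[OF e(3), of star] by (simp add: star_mult star_idempotent[OF e(1)])
    have r: "star r * (r * e * star r) = e * star r" for r
      using mult_idempotent_swap[OF e(1), of "star r"] by (simp add: mult.assoc)
    have eq: "s * e * star s = t * e * star t"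
      using e(3) es by (simp add: mult.assoc)
    have "star s * (s * e * star s) = star t * (s * e * star s)"
      using r[of s] r[of t] es eq by simp
    moreover have "s * e * star s \<in> idempotents"
      using conjugate_idempotent[OF e(1), of "star s"] by simp
    moreover have "y \<in> dom (\<alpha> (s * e * star s))"
      using action_conjugate_dom[OF A e(1) action_star(2)[OF A s]] e(2) by simp
    moreover have "y \<in> dom (\<alpha> (star t))"
      using action_star(2)[OF A tx] by blast
    ultimately have "germ \<alpha> (star s) y = germ \<alpha> (star t) y"
      unfolding germ_eq_iff[OF A ys] by blast
    then show ?thesis
      using tx by simp
  qed
  have y: "the (\<alpha> s x) = y"
    using s by simp
  show ?thesis
    unfolding germ_groupoid_def top_groupoid.simps action_star_dom[OF A]
    by (rule the_equality) (use xs y unique in blast)+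
qed


section \<open>Equivariant homeomorphisms induce isomorphisms\<close>

text \<open>A germ is a set of pairs of a semigroup element and a point, so h acts on germs by
  acting on the second components, without a choice of representatives. Equivariance with
  \<open>map_option\<close> also says that h preserves and reflects membership in every
  domain.\<close>

lemma equivariant_germ:
  assumes A: "action X \<alpha>" and C: "action Y \<gamma>"
    and eqv: "\<forall>x\<in>topspace X. \<forall>s. \<gamma> s (h x) = map_option h (\<alpha> s x)"
    and x: "x \<in> topspace X"
  shows "apsnd h ` germ \<alpha> s x = germ \<gamma> s (h x)"
proof -
  have d: "h x \<in> dom (\<gamma> t) \<longleftrightarrow> x \<in> dom (\<alpha> t)" for t
    by (simp add: dom_def eqv[rule_format, OF x])
  show ?thesis
  proof (intro equalityI subsetI)
    fix p assume "p \<in> apsnd h ` germ \<alpha> s x"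
    then obtain t y where "p = (t, h y)" "(t, y) \<in> germ \<alpha> s x"
      by auto
    then show "p \<in> germ \<gamma> s (h x)"
      by (auto simp: mem_germ[OF A] mem_germ[OF C] d simp del: domIff)
  next
    fix p assume "p \<in> germ \<gamma> s (h x)"
    moreover obtain t y where "p = (t, y)" by fastforce
    ultimately have "p = apsnd h (t, x)" "(t, x) \<in> germ \<alpha> s x"
      by (auto simp: mem_germ[OF A] mem_germ[OF C] d simp del: domIff)
    then show "p \<in> apsnd h ` germ \<alpha> s x" by blast
  qed
qed

text \<open>It suffices to pull back the generating sets, and the preimage of the germs of s over V
  is the set of germs of s over the preimage of V.\<close>

lemma equivariant_continuous_map_arrows:
  assumes A: "action X \<alpha>" and C: "action Y \<gamma>" and h: "continuous_map X Y h"
    and eqv: "\<forall>x\<in>topspace X. \<forall>s. \<gamma> s (h x) = map_option h (\<alpha> s x)"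
  shows "continuous_map (arrows (germ_groupoid X \<alpha>)) (arrows (germ_groupoid Y \<gamma>)) (image (apsnd h))"
proof -
  note top = topspace_arrows[OF A] topspace_arrows[OF C]
  have dX: "x \<in> topspace X" if "x \<in> dom (\<alpha> s)" for s x
    using that action_partial_homeo(3)[OF A] by blast
  have d: "h x \<in> dom (\<gamma> t) \<longleftrightarrow> x \<in> dom (\<alpha> t)" if "x \<in> topspace X" for t x
    by (simp add: dom_def eqv[rule_format, OF that])
  note G = equivariant_germ[OF A C eqv]
  have "openin (arrows (germ_groupoid X \<alpha>))
      (image (apsnd h) -` (germ \<gamma> s ` V) \<inter> topspace (arrows (germ_groupoid X \<alpha>)))"
    if V: "openin Y V" "V \<subseteq> dom (\<gamma> s)" for s V
  proof -
    let ?U = "{x \<in> topspace X. h x \<in> V}"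
    have U: "openin X ?U" "?U \<subseteq> dom (\<alpha> s)"
      using openin_continuous_map_preimage[OF h V(1)] V(2) d by blast+
    have "image (apsnd h) -` (germ \<gamma> s ` V) \<inter> topspace (arrows (germ_groupoid X \<alpha>)) = germ \<alpha> s ` ?U"
    proof (intro equalityI subsetI)
      fix g assume "g \<in> image (apsnd h) -` (germ \<gamma> s ` V) \<inter> topspace (arrows (germ_groupoid X \<alpha>))"
      then obtain t x v where g: "g = germ \<alpha> t x" "x \<in> dom (\<alpha> t)" "apsnd h ` g = germ \<gamma> s v" "v \<in> V"
        unfolding top by blast
      have x: "x \<in> topspace X"
        using dX g(2) .
      have "germ \<gamma> t (h x) = germ \<gamma> s v"
        using g G[OF x] by simp
      moreover have ht: "h x \<in> dom (\<gamma> t)"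
        using g(2) d[OF x] by blast
      \<comment> \<open>The equation t * e = s * e does not mention the space, so the same e
        witnesses equality of the germs at x.\<close>
      ultimately obtain e where "v = h x" "h x \<in> dom (\<gamma> s)" "e \<in> idempotents"
          "h x \<in> dom (\<gamma> e)" "t * e = s * e"
        unfolding germ_eq_iff[OF C ht] by blast
      then have "germ \<alpha> t x = germ \<alpha> s x" "h x \<in> V"
        unfolding germ_eq_iff[OF A g(2)] d[OF x] using g(4) by auto
      then show "g \<in> germ \<alpha> s ` ?U"
        using g(1) x by blast
    next
      fix g assume "g \<in> germ \<alpha> s ` ?U"
      then obtain x where x: "g = germ \<alpha> s x" "x \<in> topspace X" "h x \<in> V"
        by blast
      then show "g \<in> image (apsnd h) -` (germ \<gamma> s ` V) \<inter> topspace (arrows (germ_groupoid X \<alpha>))"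
        unfolding top using U(2) G[OF x(2)] by blast
    qed
    also have "openin (arrows (germ_groupoid X \<alpha>)) \<dots>"
      unfolding arrows_germ_groupoid
      by (rule topology_generated_by_Basis) (use U action_star_dom[OF A] in blast)
    finally show ?thesis .
  qed
  moreover have "image (apsnd h) ` topspace (arrows (germ_groupoid X \<alpha>))
      \<subseteq> topspace (arrows (germ_groupoid Y \<gamma>))"
  proof
    fix g assume "g \<in> image (apsnd h) ` topspace (arrows (germ_groupoid X \<alpha>))"
    then obtain s x where "g = apsnd h ` germ \<alpha> s x" "x \<in> dom (\<alpha> s)"
      unfolding top by blast
    then have "g = germ \<gamma> s (h x)" "h x \<in> dom (\<gamma> s)"
      using G dX d by blast+
    then show "g \<in> topspace (arrows (germ_groupoid Y \<gamma>))"
      unfolding top by blast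
  qed
  ultimately show ?thesis
    unfolding arrows_germ_groupoid[of Y] continuous_on_generated_topo_iff
    using action_star_dom[OF C] by (auto simp: topology_generated_by_topspace)
qed

lemma equivariant_homeomorphic_map_arrows:
  assumes A: "action X \<alpha>" and C: "action Y \<gamma>" and h: "homeomorphic_map X Y h"
    and eqv: "\<forall>x\<in>topspace X. \<forall>s. \<gamma> s (h x) = map_option h (\<alpha> s x)"
  shows "homeomorphic_map (arrows (germ_groupoid X \<alpha>)) (arrows (germ_groupoid Y \<gamma>)) (image (apsnd h))"
proof -
  obtain k where k: "homeomorphic_maps X Y h k"
    using h homeomorphic_map_maps by blast
  have hc: "continuous_map X Y h" and kc: "continuous_map Y X k"
    and kh: "\<And>x. x \<in> topspace X \<Longrightarrow> k (h x) = x" and hk: "\<And>y. y \<in> topspace Y \<Longrightarrow> h (k y) = y"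
    using k by (auto simp: homeomorphic_maps_def)
  have kX: "k y \<in> topspace X" if "y \<in> topspace Y" for y
    using kc that by (auto simp: continuous_map_def)
  have hY: "h x \<in> topspace Y" if "x \<in> topspace X" for x
    using hc that by (auto simp: continuous_map_def)
  \<comment> \<open>The inverse homeomorphism is equivariant as well, so continuity of the inverse
    map on arrows is the same lemma with X and Y exchanged.\<close>
  have keqv: "\<forall>y\<in>topspace Y. \<forall>s. \<alpha> s (k y) = map_option k (\<gamma> s y)"
  proof (intro ballI allI)
    fix y s assume y: "y \<in> topspace Y"
    have *: "\<gamma> s y = map_option h (\<alpha> s (k y))"
      using eqv[rule_format, OF kX[OF y], of s] hk[OF y] by simp
    show "\<alpha> s (k y) = map_option k (\<gamma> s y)"
    proof (cases "\<alpha> s (k y)")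
      case (Some z)
      then have "k (h z) = z"
        using action_partial_homeo(3)[OF A] kh by blast
      with * Some show ?thesis by simp
    qed (use * in simp)
  qed
  have "apsnd k ` apsnd h ` g = g" if g: "g \<in> topspace (arrows (germ_groupoid X \<alpha>))" for g
  proof -
    from g obtain s x where g: "g = germ \<alpha> s x" "x \<in> dom (\<alpha> s)"
      unfolding topspace_arrows[OF A] by blast
    then have x: "x \<in> topspace X"
      using action_partial_homeo(3)[OF A] by blast
    show ?thesis
      unfolding g equivariant_germ[OF A C eqv x] equivariant_germ[OF C A keqv hY[OF x]] kh[OF x] ..
  qed
  moreover have "apsnd h ` apsnd k ` g = g" if g: "g \<in> topspace (arrows (germ_groupoid Y \<gamma>))" for g
  proof -
    from g obtain s y where g: "g = germ \<gamma> s y" "y \<in> dom (\<gamma> s)"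
      unfolding topspace_arrows[OF C] by blast
    then have y: "y \<in> topspace Y"
      using action_partial_homeo(3)[OF C] by blast
    show ?thesis
      unfolding g equivariant_germ[OF C A keqv y] equivariant_germ[OF A C eqv kX[OF y]] hk[OF y] ..
  qed
  ultimately have "homeomorphic_maps (arrows (germ_groupoid X \<alpha>)) (arrows (germ_groupoid Y \<gamma>))
      (image (apsnd h)) (image (apsnd k))"
    using equivariant_continuous_map_arrows[OF A C hc eqv]
      equivariant_continuous_map_arrows[OF C A kc keqv]
    by (simp add: homeomorphic_maps_def)
  then show ?thesis
    using homeomorphic_map_maps by blast
qed

lemma equivariant_groupoid_isomorphic:
  assumes A: "action X \<alpha>" and C: "action Y \<gamma>" and h: "homeomorphic_map X Y h"
    and eqv: "\<forall>x\<in>topspace X. \<forall>s. \<gamma> s (h x) = map_option h (\<alpha> s x)"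
  shows "groupoid_isomorphic (germ_groupoid X \<alpha>) (germ_groupoid Y \<gamma>)"
  unfolding groupoid_isomorphic_def
proof (intro exI[of _ "image (apsnd h)"] exI[of _ h] conjI ballI impI)
  let ?G = "germ_groupoid X \<alpha>" and ?H = "germ_groupoid Y \<gamma>"
  show "homeomorphic_map (arrows ?G) (arrows ?H) (image (apsnd h))"
    using equivariant_homeomorphic_map_arrows[OF A C h eqv] .
  show "homeomorphic_map (units ?G) (units ?H) h"
    using h by simp
  note G = equivariant_germ[OF A C eqv]
  have arrow: "\<exists>s x y. g = germ \<alpha> s x \<and> \<alpha> s x = Some y \<and> x \<in> topspace X \<and> y \<in> topspace X
      \<and> \<gamma> s (h x) = Some (h y) \<and> apsnd h ` g = germ \<gamma> s (h x)"
    if g: "g \<in> topspace (arrows ?G)" for g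
  proof -
    obtain s x y where *: "g = germ \<alpha> s x" "\<alpha> s x = Some y"
      using g unfolding topspace_arrows[OF A] by blast
    then show ?thesis
      using action_partial_homeo(3)[OF A *(2)] eqv[rule_format, of x s] G[of x s] by auto
  qed
  {
    fix x assume "x \<in> topspace (units ?G)"
    then have x: "x \<in> topspace X" by simp
    then obtain e where e: "e \<in> idempotents" "x \<in> dom (\<alpha> e)"
      using A unfolding action_def by blast
    then have "h x \<in> dom (\<gamma> e)"
      using eqv[rule_format, OF x] by (simp add: dom_def)
    then show "apsnd h ` unit_at ?G x = unit_at ?H (h x)"
      using unit_at_germ_groupoid[OF A e] unit_at_germ_groupoid[OF C e(1)] G[OF x] by simp
  }
  {
    fix g assume "g \<in> topspace (arrows ?G)"
    then obtain s x y where g: "g = germ \<alpha> s x" "\<alpha> s x = Some y" "x \<in> topspace X" "y \<in> topspace X"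
      "\<gamma> s (h x) = Some (h y)" "apsnd h ` g = germ \<gamma> s (h x)"
      using arrow by meson
    show "src ?H (apsnd h ` g) = h (src ?G g)"
      unfolding g(6) unfolding g(1)
      using src_germ_groupoid[OF A domI[of "\<alpha> s", OF g(2)]]
        src_germ_groupoid[OF C domI[of "\<gamma> s", OF g(5)]] by simp
    show "rng ?H (apsnd h ` g) = h (rng ?G g)"
      unfolding g(6) unfolding g(1)
      using rng_germ_groupoid[OF A g(2)] rng_germ_groupoid[OF C g(5)] by simp
    show "apsnd h ` ginv ?G g = ginv ?H (apsnd h ` g)"
      unfolding g(6) unfolding g(1)
      unfolding ginv_germ_groupoid[OF A g(2)] ginv_germ_groupoid[OF C g(5)] G[OF g(4)] ..
    fix g' assume g': "g' \<in> topspace (arrows ?G)" "src ?G g = rng ?G g'"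
    then obtain t w z where t: "g' = germ \<alpha> t w" "\<alpha> t w = Some z" "w \<in> topspace X" "z \<in> topspace X"
      "\<gamma> t (h w) = Some (h z)" "apsnd h ` g' = germ \<gamma> t (h w)"
      using arrow by meson
    have z: "z = x"
      using g'(2) src_germ_groupoid[OF A domI[of "\<alpha> s", OF g(2)]] rng_germ_groupoid[OF A t(2)] g(1) t(1) by simp
    have "gcomp ?G g g' = germ \<alpha> (s * t) w"
      unfolding g(1) t(1) using gcomp_germ_groupoid[OF A t(2), of s] g(2) z by auto
    moreover have "gcomp ?H (germ \<gamma> s (h x)) (germ \<gamma> t (h w)) = germ \<gamma> (s * t) (h w)"
      using gcomp_germ_groupoid[OF C t(5), of s] g(5) z by auto
    ultimately show "apsnd h ` gcomp ?G g g' = gcomp ?H (apsnd h ` g) (apsnd h ` g')"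
      unfolding g(6) t(6) using G[OF t(3)] by simp
  }
qed


section \<open>The spectral action on the ultracharacters\<close>

text \<open>This is an action whether or not the ultracharacters are compact; it agrees with
  \<open>tight_action\<close> as soon as all tight characters are ultracharacters.\<close>

definition ultra_action :: "'s::inverse_semigroup \<Rightarrow> ('s \<Rightarrow> bool) \<rightharpoonup> ('s \<Rightarrow> bool)" where
  "ultra_action s = spectral_action s |` ultracharacters"

abbreviation conjugate_character ::
    "'s::inverse_semigroup \<Rightarrow> ('s \<Rightarrow> bool) \<Rightarrow> ('s \<Rightarrow> bool)" where
  "conjugate_character s \<xi> \<equiv> (\<lambda>e\<in>idempotents. \<xi> (star s * e * s))"

lemma ultra_action_simp:
  "ultra_action s \<xi> = (if \<xi> \<in> ultracharacters \<and> \<xi> (star s * s)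
     then Some (conjugate_character s \<xi>) else None)"
  using ultracharacters_subset by (auto simp: ultra_action_def spectral_action_def restrict_map_def)

lemma dom_ultra_action: "dom (ultra_action s) = {\<xi> \<in> ultracharacters. \<xi> (star s * s)}"
  by (auto simp: ultra_action_simp dom_def)

lemma dom_ultra_action_idempotent:
  "e \<in> idempotents \<Longrightarrow> dom (ultra_action e) = {\<xi> \<in> ultracharacters. \<xi> e}"
  by (simp add: dom_ultra_action star_idempotent idempotentsD)

text \<open>If the conjugate fails at e, then some f with \<xi> f is orthogonal to star s * e * s.
  Then s * f * star s is orthogonal to e, by moving e past s, and the conjugate holds at it.\<close>

lemma conjugate_ultracharacter:
  assumes \<xi>: "\<xi> \<in> ultracharacters" and s: "\<xi> (star s * s)"
  shows "conjugate_character s \<xi> \<in> ultracharacters" "conjugate_character s \<xi> (s * star s)"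
proof -
  have \<xi>c: "\<xi> \<in> characters"
    using \<xi> ultracharacters_subset by blast
  have ss: "star s * (s * star s) * s = star s * s"
    using star_inverse(2)[of s] by (simp flip: mult.assoc)
  then show 1: "conjugate_character s \<xi> (s * star s)"
    using s by simp
  have c: "conjugate_character s \<xi> \<in> characters"
    unfolding characters_def
  proof (intro CollectI conjI ballI)
    show "\<exists>e\<in>idempotents. conjugate_character s \<xi> e"
      using 1 by (intro bexI[of _ "s * star s"]) auto
    show "conjugate_character s \<xi> (e * f) = (conjugate_character s \<xi> e \<and> conjugate_character s \<xi> f)"
      if "e \<in> idempotents" "f \<in> idempotents" for e f
      using that characterD(1)[OF \<xi>c conjugate_idempotent conjugate_idempotent, of e f s s]
      by (simp add: idempotent_mult_idempotent conjugate_mult)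
  qed (use characterD(3)[OF \<xi>c] in auto)
  have "\<exists>g\<in>idempotents. conjugate_character s \<xi> g \<and> e * g = 0"
    if e: "e \<in> idempotents" "\<not> conjugate_character s \<xi> e" for e
  proof -
    have "\<not> \<xi> (star s * e * s)"
      using e by simp
    then obtain f where f: "f \<in> idempotents" "\<xi> f" "star s * e * s * f = 0"
      using \<xi> conjugate_idempotent[OF e(1)] unfolding ultracharacters_iff by blast
    let ?g = "s * f * star s"
    have g: "?g \<in> idempotents"
      using conjugate_idempotent[OF f(1), of "star s"] by simp
    have "star s * ?g * s = (star s * s) * (f * (star s * s))"
      by (simp add: mult.assoc)
    then have "\<xi> (star s * ?g * s)"
      using s f characterD(1)[OF \<xi>c] by (simp add: idempotent_mult_idempotent)
    moreover have "e * ?g = s * (star s * e * s * f) * star s"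
      using mult_idempotent_swap[OF e(1), of s] by (simp flip: mult.assoc)
    then have "e * ?g = 0"
      using f(3) by simp
    ultimately show ?thesis
      using g by (intro bexI[of _ ?g]) auto
  qed
  then show "conjugate_character s \<xi> \<in> ultracharacters"
    using c unfolding ultracharacters_iff by blast
qed

lemma conjugate_character_star:
  assumes \<xi>: "\<xi> \<in> ultracharacters" and s: "\<xi> (star s * s)"
  shows "conjugate_character (star s) (conjugate_character s \<xi>) = \<xi>"
proof (rule extensionalityI[of _ idempotents])
  have \<xi>c: "\<xi> \<in> characters"
    using \<xi> ultracharacters_subset by blast
  then show "\<xi> \<in> extensional idempotents"
    by (rule characterD)
  fix e :: 'a assume e: "e \<in> idempotents"
  have "star s * (s * e * star s) * s = (star s * s) * (e * (star s * s))"
    by (simp add: mult.assoc)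
  then show "conjugate_character (star s) (conjugate_character s \<xi>) e = \<xi> e"
    using e s characterD(1)[OF \<xi>c] conjugate_idempotent[OF e, of "star s"]
    by (simp add: idempotent_mult_idempotent)
qed simp

text \<open>Each coordinate of the image is a coordinate of the argument, at the conjugated
  idempotent.\<close>

lemma continuous_map_conjugate_character:
  "continuous_map (subtopology ultra_space {\<xi> \<in> ultracharacters. \<xi> (star s * s)})
     (subtopology ultra_space {\<xi> \<in> ultracharacters. \<xi> (s * star s)}) (conjugate_character s)"
  unfolding continuous_map_in_subtopology
proof
  show "continuous_map (subtopology ultra_space {\<xi> \<in> ultracharacters. \<xi> (star s * s)})
     ultra_space (conjugate_character s)"
  proof (rule continuous_map_into_ultra_space)
    fix e :: 'a assume "e \<in> idempotents"
    then show "continuous_map (subtopology ultra_space {\<xi> \<in> ultracharacters. \<xi> (star s * s)})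
      (discrete_topology UNIV) (\<lambda>\<xi>. conjugate_character s \<xi> e)"
      by (auto intro!: continuous_map_from_subtopology continuous_map_evaluation conjugate_idempotent)
  qed (auto intro: conjugate_ultracharacter)
qed (auto dest: conjugate_ultracharacter)

lemma ran_ultra_action: "ran (ultra_action s) = {\<xi> \<in> ultracharacters. \<xi> (s * star s)}"
proof (intro equalityI subsetI)
  fix \<eta> assume "\<eta> \<in> ran (ultra_action s)"
  then obtain \<xi> where "ultra_action s \<xi> = Some \<eta>"
    by (auto simp: ran_def)
  then show "\<eta> \<in> {\<xi> \<in> ultracharacters. \<xi> (s * star s)}"
    using conjugate_ultracharacter[of \<xi> s] by (auto simp: ultra_action_simp split: if_splits)
next
  fix \<eta> assume \<eta>: "\<eta> \<in> {\<xi> \<in> ultracharacters. \<xi> (s * star s)}"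
  then have "ultra_action s (conjugate_character (star s) \<eta>) = Some \<eta>"
    using conjugate_ultracharacter[of \<eta> "star s"] conjugate_character_star[of \<eta> "star s"]
    by (simp add: ultra_action_simp)
  then show "\<eta> \<in> ran (ultra_action s)"
    unfolding ran_def by blast
qed

lemma ultra_action_partial_homeo: "ultra_action s \<in> partial_homeos ultra_space"
proof -
  let ?D = "subtopology ultra_space {\<xi> \<in> ultracharacters. \<xi> (star s * s)}"
    and ?R = "subtopology ultra_space {\<xi> \<in> ultracharacters. \<xi> (s * star s)}"
  have "homeomorphic_maps ?D ?R (conjugate_character s) (conjugate_character (star s))"
    unfolding homeomorphic_maps_def
    using continuous_map_conjugate_character[of s] continuous_map_conjugate_character[of "star s"]
      conjugate_character_star[of _ s] conjugate_character_star[of _ "star s"]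
    by auto
  then have "homeomorphic_map ?D ?R (conjugate_character s)"
    using homeomorphic_map_maps by blast
  then have "homeomorphic_map ?D ?R (the \<circ> ultra_action s)"
    by (rule homeomorphic_map_eq) (simp add: ultra_action_simp)
  then show ?thesis
    by (simp add: partial_homeos_def dom_ultra_action ran_ultra_action clopen_evaluation)
qed

lemma ultra_action_mult:
  "ultra_action (s * t) = ultra_action s \<circ>\<^sub>m ultra_action t"
proof
  fix \<xi> :: "'a \<Rightarrow> bool"
  show "ultra_action (s * t) \<xi> = (ultra_action s \<circ>\<^sub>m ultra_action t) \<xi>"
  proof (cases "\<xi> \<in> ultracharacters")
    case True
    then have \<xi>: "\<xi> \<in> characters"
      using ultracharacters_subset by blast
    have st: "star (s * t) * e * (s * t) = star t * (star s * e * s) * t" for e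
      by (simp add: star_mult mult.assoc)
    have st1: "star (s * t) * (s * t) = star t * (star s * s) * t"
      by (simp add: star_mult mult.assoc)
    \<comment> \<open>The conjugated idempotent lies below star t * t. Hence the domain condition
      for s * t includes the one for t, and both sides are defined at the same characters.\<close>
    have "star t * (star s * s) * t * (star t * t) = star t * (star s * s) * t"
      by (simp add: mult.assoc star_inverse[unfolded mult.assoc])
    then have "\<xi> (star t * (star s * s) * t) \<Longrightarrow> \<xi> (star t * t)"
      using characterD(1)[OF \<xi> conjugate_idempotent[of "star s * s" t], of "star t * t"] by simp
    moreover have "conjugate_character (s * t) \<xi> = conjugate_character s (conjugate_character t \<xi>)"
      by (auto simp: st conjugate_idempotent)
    ultimately show ?thesis
      using True conjugate_ultracharacter[of \<xi> t]
      by (auto simp: ultra_action_simp st1 map_comp_def)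
  qed (simp add: ultra_action_simp map_comp_def)
qed

lemma ultra_action_action: "action ultra_space ultra_action"
  unfolding action_def
proof (intro conjI allI)
  show "(\<Union>e\<in>idempotents. dom (ultra_action e)) = topspace ultra_space"
    using ultracharacters_subset by (auto simp: dom_ultra_action_idempotent dest!: characterD(2))
  show "dom (ultra_action 0) = {}"
    using ultracharacters_subset by (auto simp: dom_ultra_action_idempotent dest: characterD(3))
qed (rule ultra_action_partial_homeo ultra_action_mult)+

lemma ultra_action_nonvanishing: "nonvanishing ultra_action"
  unfolding nonvanishing_def
proof (intro ballI impI)
  fix e :: 'a assume e: "e \<in> idempotents" "e \<noteq> 0"
  then obtain \<xi> where "\<xi> \<in> ultracharacters" "\<xi> e"
    using ultracharacter_exists by blast
  then show "dom (ultra_action e) \<noteq> {}"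
    unfolding dom_ultra_action_idempotent[OF e(1)] by blast
qed

lemma ultra_action_strongly_tight:
  assumes "compact_space (ultra_space :: ('s::inverse_semigroup \<Rightarrow> bool) topology)"
  shows "strongly_tight ultra_space (ultra_action :: 's \<Rightarrow> _)"
  unfolding strongly_tight_def
proof (intro conjI ballI)
  show "compactin ultra_space (dom (ultra_action e))" if "e \<in> idempotents" for e :: 's
    using that assms by (auto simp: dom_ultra_action_idempotent intro: closedin_compact_space clopen_evaluation)
  show "openin ultra_space = arbitrary union_of
      (\<lambda>U. U \<in> (\<lambda>e::'s. dom (ultra_action e)) ` idempotents)"
    unfolding openin_topology_base_unique
  proof (intro conjI allI impI; (elim conjE)?)
    fix V assume "V \<in> (\<lambda>e::'s. dom (ultra_action e)) ` idempotents"
    then show "openin ultra_space V"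
      by (auto simp: dom_ultra_action_idempotent clopen_evaluation)
  next
    fix U and \<xi> :: "'s \<Rightarrow> bool"
    assume U: "openin ultra_space U" "\<xi> \<in> U"
    then have "\<xi> \<in> ultracharacters"
      using openin_subset by fastforce
    moreover obtain e where "e \<in> idempotents" "\<xi> e" "{\<eta> \<in> ultracharacters. \<eta> e} \<subseteq> U"
      using ultra_space_basis[OF U] by blast
    ultimately show "\<exists>V. V \<in> (\<lambda>e::'s. dom (ultra_action e)) ` idempotents \<and> \<xi> \<in> V \<and> V \<subseteq> U"
      using dom_ultra_action_idempotent by (metis (mono_tags, lifting) imageI mem_Collect_eq)
  qed
qed


section \<open>Strongly tight actions\<close>

definition point_character ::
    "('s::inverse_semigroup \<Rightarrow> 'x \<rightharpoonup> 'x) \<Rightarrow> 'x \<Rightarrow> ('s \<Rightarrow> bool)" where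
  "point_character \<alpha> x = (\<lambda>e\<in>idempotents. x \<in> dom (\<alpha> e))"

lemma point_character_character:
  assumes A: "action X \<alpha>" and x: "x \<in> topspace X"
  shows "point_character \<alpha> x \<in> characters"
proof -
  have "\<exists>e\<in>idempotents. x \<in> dom (\<alpha> e)" "x \<notin> dom (\<alpha> 0)"
    using A x unfolding action_def by blast+
  then show ?thesis
    by (auto simp: characters_def point_character_def action_dom_mult[OF A] idempotent_mult_idempotent
        simp del: domIff)
qed

locale strongly_tight_action =
  fixes X :: "'x topology" and \<alpha> :: "'s::inverse_semigroup \<Rightarrow> 'x \<rightharpoonup> 'x"
  assumes compact: "compact_space X" and Hausdorff: "Hausdorff_space X"
    and action: "action X \<alpha>" and strongly_tight: "strongly_tight X \<alpha>"
    and nonvanishing: "nonvanishing \<alpha>"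
begin

lemma clopen_dom:
  assumes "e \<in> idempotents"
  shows "openin X (dom (\<alpha> e))" "closedin X (dom (\<alpha> e))"
  using assms strongly_tight Hausdorff compactin_imp_closedin action_partial_homeo(1)[OF action]
  by (auto simp: strongly_tight_def)

lemma basis:
  assumes "openin X U" "x \<in> U"
  shows "\<exists>e\<in>idempotents. x \<in> dom (\<alpha> e) \<and> dom (\<alpha> e) \<subseteq> U"
proof -
  have "openin X = arbitrary union_of (\<lambda>U. U \<in> (\<lambda>e. dom (\<alpha> e)) ` idempotents)"
    using strongly_tight by (simp add: strongly_tight_def)
  then have "\<exists>V. V \<in> (\<lambda>e. dom (\<alpha> e)) ` idempotents \<and> x \<in> V \<and> V \<subseteq> U"
    using assms unfolding openin_topology_base_unique by simp
  then show ?thesis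
    by blast
qed

text \<open>The domain of f is compact in a Hausdorff space, so its complement is an open
  neighbourhood of x and contains a basic set around x. The idempotent of that basic set is
  orthogonal to f because the action is nonvanishing.\<close>

lemma point_character_ultracharacter:
  assumes x: "x \<in> topspace X"
  shows "point_character \<alpha> x \<in> ultracharacters"
  unfolding ultracharacters_iff
proof (intro conjI ballI impI)
  show "point_character \<alpha> x \<in> characters"
    using point_character_character[OF action x] .
  fix f assume f: "f \<in> idempotents" "\<not> point_character \<alpha> x f"
  then have "openin X (topspace X - dom (\<alpha> f))" "x \<in> topspace X - dom (\<alpha> f)"
    using clopen_dom x by (auto simp: point_character_def)
  then obtain e where e: "e \<in> idempotents" "x \<in> dom (\<alpha> e)" "dom (\<alpha> e) \<subseteq> topspace X - dom (\<alpha> f)"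
    using basis by meson
  then have "dom (\<alpha> (f * e)) = {}"
    using action_dom_mult[OF action f(1) e(1)] by blast
  then have "f * e = 0"
    using nonvanishing e f idempotent_mult_idempotent unfolding nonvanishing_def by blast
  then show "\<exists>e\<in>idempotents. point_character \<alpha> x e \<and> f * e = 0"
    using e by (auto simp: point_character_def simp del: domIff)
qed

text \<open>The product of finitely many idempotents on which \<xi> holds is again one of these,
  hence nonzero, hence has nonempty domain. This is the finite intersection property needed for
  surjectivity.\<close>

lemma ultracharacter_dom_nonempty:
  assumes \<xi>: "\<xi> \<in> ultracharacters" and J: "finite J" "J \<subseteq> {e \<in> idempotents. \<xi> e}"
  shows "topspace X \<inter> (\<Inter>e\<in>J. dom (\<alpha> e)) \<noteq> {}"
proof -
  have \<xi>c: "\<xi> \<in> characters"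
    using \<xi> ultracharacters_subset by blast
  have "\<exists>f\<in>idempotents. \<xi> f \<and> dom (\<alpha> f) \<subseteq> topspace X \<inter> (\<Inter>e\<in>J. dom (\<alpha> e))"
    using J
  proof (induction J rule: finite_induct)
    case empty
    obtain e where "e \<in> idempotents" "\<xi> e"
      using characterD(2)[OF \<xi>c] by blast
    then show ?case
      using clopen_dom openin_subset by fastforce
  next
    case (insert e J)
    then obtain f where f: "f \<in> idempotents" "\<xi> f" "dom (\<alpha> f) \<subseteq> topspace X \<inter> (\<Inter>e\<in>J. dom (\<alpha> e))"
      by auto
    have e: "e \<in> idempotents" "\<xi> e"
      using insert by auto
    show ?case
      using f e by (intro bexI[of _ "e * f"])
        (auto simp: action_dom_mult[OF action] idempotent_mult_idempotent characterD(1)[OF \<xi>c]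
          simp del: domIff)
  qed
  then obtain f where f: "f \<in> idempotents" "\<xi> f" "dom (\<alpha> f) \<subseteq> topspace X \<inter> (\<Inter>e\<in>J. dom (\<alpha> e))"
    by blast
  then have "f \<noteq> 0"
    using characterD(3)[OF \<xi>c] by blast
  then have "dom (\<alpha> f) \<noteq> {}"
    using nonvanishing f(1) by (simp add: nonvanishing_def)
  with f(3) show ?thesis by blast
qed

lemma point_character_surj:
  assumes \<xi>: "\<xi> \<in> ultracharacters"
  shows "\<exists>x\<in>topspace X. point_character \<alpha> x = \<xi>"
proof -
  let ?U = "(\<lambda>e. dom (\<alpha> e)) ` {e \<in> idempotents. \<xi> e}"
  have \<xi>c: "\<xi> \<in> characters"
    using \<xi> ultracharacters_subset by blast
  have "\<Inter>F \<noteq> {}" if "finite F" "F \<subseteq> ?U" for F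
  proof -
    from finite_subset_image[OF that]
    obtain J where "finite J" "J \<subseteq> {e \<in> idempotents. \<xi> e}" "F = (\<lambda>e. dom (\<alpha> e)) ` J"
      by blast
    then show ?thesis
      using ultracharacter_dom_nonempty[OF \<xi>, of J] by blast
  qed
  moreover have "\<forall>C\<in>?U. closedin X C"
    using clopen_dom(2) by blast
  ultimately have "\<Inter>?U \<noteq> {}"
    using compact[unfolded compact_space_fip, rule_format, of ?U] by blast
  then obtain x where x: "\<And>e. e \<in> idempotents \<Longrightarrow> \<xi> e \<Longrightarrow> x \<in> dom (\<alpha> e)"
    by blast
  obtain e where "e \<in> idempotents" "\<xi> e"
    using characterD(2)[OF \<xi>c] by blast
  then have xX: "x \<in> topspace X"
    using x clopen_dom(1) openin_subset by blast
  note p = point_character_character[OF action xX]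
  \<comment> \<open>By the choice of x, the point character dominates \<xi>. It cannot be larger at
    e, since it would then hold at both factors of a product e * f = 0.\<close>
  have "point_character \<alpha> x e = \<xi> e" if e: "e \<in> idempotents" for e
  proof (cases "\<xi> e")
    case True
    then show ?thesis
      using x[OF e] e by (simp add: point_character_def del: domIff)
  next
    case False
    then obtain f where f: "f \<in> idempotents" "\<xi> f" "e * f = 0"
      using \<xi> e unfolding ultracharacters_iff by blast
    then have "point_character \<alpha> x f"
      using x by (simp add: point_character_def del: domIff)
    then have "\<not> point_character \<alpha> x e"
      using characterD(1)[OF p e f(1)] characterD(3)[OF p] f(3) by simp
    with False show ?thesis by simp
  qed
  then have "point_character \<alpha> x = \<xi>"
    by (rule character_eqI[OF p \<xi>c])
  with xX show ?thesis by blast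
qed

lemma point_character_inj: "inj_on (point_character \<alpha>) (topspace X)"
proof (rule inj_onI, rule ccontr)
  fix x y
  assume xy: "x \<in> topspace X" "y \<in> topspace X" "point_character \<alpha> x = point_character \<alpha> y" "x \<noteq> y"
  then obtain U V where "openin X U" "openin X V" "x \<in> U" "y \<in> V" "disjnt U V"
    using Hausdorff unfolding Hausdorff_space_def by metis
  then obtain e where e: "e \<in> idempotents" "x \<in> dom (\<alpha> e)" "dom (\<alpha> e) \<subseteq> U" "y \<notin> U"
    using basis[of U x] by (auto simp: disjnt_iff)
  then show False
    using fun_cong[OF xy(3), of e] by (auto simp: point_character_def simp del: domIff)
qed

lemma point_character_image: "point_character \<alpha> ` topspace X = ultracharacters"
  using point_character_ultracharacter point_character_surj by blast

lemma point_character_continuous: "continuous_map X ultra_space (point_character \<alpha>)"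
proof (rule continuous_map_into_ultra_space)
  fix e :: 's assume e: "e \<in> idempotents"
  have "openin X {x \<in> topspace X. point_character \<alpha> x e \<in> A}" for A
  proof -
    have "{x \<in> topspace X. point_character \<alpha> x e \<in> A} =
      (if True \<in> A then dom (\<alpha> e) else {}) \<union> (if False \<in> A then topspace X - dom (\<alpha> e) else {})"
    proof (intro set_eqI)
      show "x \<in> {x \<in> topspace X. point_character \<alpha> x e \<in> A} \<longleftrightarrow>
        x \<in> (if True \<in> A then dom (\<alpha> e) else {}) \<union> (if False \<in> A then topspace X - dom (\<alpha> e) else {})" for x
        using e openin_subset[OF clopen_dom(1)[OF e]]
        by (cases "x \<in> dom (\<alpha> e)") (auto simp: point_character_def simp del: domIff)
    qed
    then show ?thesis
      using clopen_dom[OF e] by auto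
  qed
  then show "continuous_map X (discrete_topology UNIV) (\<lambda>x. point_character \<alpha> x e)"
    by (simp add: continuous_map_def)
qed (use point_character_ultracharacter in auto)

lemma compact_ultra_space: "compact_space (ultra_space :: ('s \<Rightarrow> bool) topology)"
  using image_compactin[OF _ point_character_continuous, of "topspace X"] compact
  by (simp add: compact_space_def point_character_image)

text \<open>A continuous bijection from a compact space onto a Hausdorff space is a
  homeomorphism.\<close>

lemma point_character_homeomorphic: "homeomorphic_map X ultra_space (point_character \<alpha>)"
proof (rule continuous_imp_homeomorphic_map[OF point_character_continuous compact])
  show "Hausdorff_space (ultra_space :: ('s \<Rightarrow> bool) topology)"
    by (rule Hausdorff_ultra_space)
qed (simp_all add: point_character_inj point_character_image)

lemma point_character_equivariant:
  "\<forall>x\<in>topspace X. \<forall>s. ultra_action s (point_character \<alpha> x) = map_option (point_character \<alpha>) (\<alpha> s x)"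
proof (intro ballI allI)
  fix x s assume x: "x \<in> topspace X"
  have d: "point_character \<alpha> x (star s * s) \<longleftrightarrow> x \<in> dom (\<alpha> s)"
    by (simp add: point_character_def action_star_dom[OF action] del: domIff)
  show "ultra_action s (point_character \<alpha> x) = map_option (point_character \<alpha>) (\<alpha> s x)"
  proof (cases "\<alpha> s x")
    case None
    then show ?thesis
      using d by (auto simp: ultra_action_simp)
  next
    case (Some y)
    have "conjugate_character s (point_character \<alpha> x) = point_character \<alpha> y"
      unfolding point_character_def using action_conjugate_dom[OF action _ Some]
      by (intro restrict_ext) (simp add: conjugate_idempotent del: domIff)
    then show ?thesis
      using Some d point_character_ultracharacter[OF x] by (auto simp: ultra_action_simp)
  qed
qed

lemma groupoid_isomorphic_tight:
  "groupoid_isomorphic (germ_groupoid X \<alpha>)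
     (tight_groupoid :: (('s \<times> ('s \<Rightarrow> bool)) set, 's \<Rightarrow> bool) top_groupoid)"
proof -
  have eq: "(tight_characters :: ('s \<Rightarrow> bool) set) = ultracharacters"
    using tight_eq_ultra_if_compact compact_ultra_space .
  have "tight_action = (ultra_action :: 's \<Rightarrow> _)"
    by (rule ext) (simp add: tight_action_def ultra_action_def eq)
  then have "(tight_groupoid :: (('s \<times> ('s \<Rightarrow> bool)) set, 's \<Rightarrow> bool) top_groupoid)
      = germ_groupoid ultra_space ultra_action"
    by (simp add: tight_groupoid_def tight_space_def ultra_space_def eq)
  then show ?thesis
    using equivariant_groupoid_isomorphic[OF action ultra_action_action point_character_homeomorphic
        point_character_equivariant] by simp
qed

end

text \<open>The existential ranges over spaces whose points have the type of characters, where
  \<open>ultra_space\<close> itself is the witness. The last conjunct derives compactness, together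
  with the isomorphism, from an action on a space with points of any type \<open>'x\<close>, so
  fixing the type in the first conjunct does not weaken the equivalence.\<close>

theorem corollary6p2p4:
  shows
    "((\<exists>(X :: ('s::inverse_semigroup \<Rightarrow> bool) topology) (\<alpha> :: 's \<Rightarrow> ('s \<Rightarrow> bool) \<rightharpoonup> ('s \<Rightarrow> bool)).
         compact_space X \<and> Hausdorff_space X \<and>
         action X \<alpha> \<and> strongly_tight X \<alpha> \<and> nonvanishing \<alpha>)
       \<longleftrightarrow> compact_space (ultra_space :: ('s \<Rightarrow> bool) topology)) \<and>
     (compact_space (ultra_space :: ('s \<Rightarrow> bool) topology) \<longrightarrow>
        (tight_characters :: ('s \<Rightarrow> bool) set) = ultracharacters) \<and>
     (has_unit TYPE('s) \<longrightarrow>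
        (tight_characters :: ('s \<Rightarrow> bool) set) = ultracharacters \<longrightarrow>
        compact_space (ultra_space :: ('s \<Rightarrow> bool) topology)) \<and>
     (\<forall>(X :: 'x topology) (\<alpha> :: 's \<Rightarrow> 'x \<rightharpoonup> 'x).
        compact_space X \<and> Hausdorff_space X \<and>
        action X \<alpha> \<and> strongly_tight X \<alpha> \<and> nonvanishing \<alpha> \<longrightarrow>
          compact_space (ultra_space :: ('s \<Rightarrow> bool) topology) \<and>
          groupoid_isomorphic (germ_groupoid X \<alpha>) (tight_groupoid :: (('s \<times> ('s \<Rightarrow> bool)) set, 's \<Rightarrow> bool) top_groupoid))"
proof (intro conjI impI allI iffI)
  assume "\<exists>(X :: ('s \<Rightarrow> bool) topology) (\<alpha> :: 's \<Rightarrow> ('s \<Rightarrow> bool) \<rightharpoonup> ('s \<Rightarrow> bool)).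
    compact_space X \<and> Hausdorff_space X \<and> action X \<alpha> \<and> strongly_tight X \<alpha> \<and> nonvanishing \<alpha>"
  then obtain X :: "('s \<Rightarrow> bool) topology" and \<alpha> :: "'s \<Rightarrow> ('s \<Rightarrow> bool) \<rightharpoonup> ('s \<Rightarrow> bool)"
    where "strongly_tight_action X \<alpha>"
    unfolding strongly_tight_action_def by blast
  then show "compact_space (ultra_space :: ('s \<Rightarrow> bool) topology)"
    by (rule strongly_tight_action.compact_ultra_space)
next
  assume c: "compact_space (ultra_space :: ('s \<Rightarrow> bool) topology)"
  then show "\<exists>(X :: ('s \<Rightarrow> bool) topology) (\<alpha> :: 's \<Rightarrow> ('s \<Rightarrow> bool) \<rightharpoonup> ('s \<Rightarrow> bool)).
    compact_space X \<and> Hausdorff_space X \<and> action X \<alpha> \<and> strongly_tight X \<alpha> \<and> nonvanishing \<alpha>"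
    using c Hausdorff_ultra_space ultra_action_action ultra_action_strongly_tight[OF c] ultra_action_nonvanishing by blast
next
  fix X :: "'x topology" and \<alpha> :: "'s \<Rightarrow> 'x \<rightharpoonup> 'x"
  assume "compact_space X \<and> Hausdorff_space X \<and>
    action X \<alpha> \<and> strongly_tight X \<alpha> \<and> nonvanishing \<alpha>"
  then interpret strongly_tight_action X \<alpha>
    by unfold_locales auto
  show "compact_space (ultra_space :: ('s \<Rightarrow> bool) topology)"
    by (rule compact_ultra_space)
  show "groupoid_isomorphic (germ_groupoid X \<alpha>)
      (tight_groupoid :: (('s \<times> ('s \<Rightarrow> bool)) set, 's \<Rightarrow> bool) top_groupoid)"
    by (rule groupoid_isomorphic_tight)
qed (use tight_eq_ultra_if_compact compact_ultra_space_if_tight_eq_ultra in blast)+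

end
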